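(* Let $R$ be a commutative noetherian ring and $\mathcal X$ a subcategory of $\operatorname{mod}R$ such that for every prime ideal $\mathfrak p\in\operatorname{Ass}\mathcal X$ there exists $X\in\mathcal X$ with $\operatorname{Ass}X=\{\mathfrak p\}$. Put $\Delta=\operatorname{Ass}\mathcal X$. Then for every specialization-closed subset $Z$ of $\Delta$ one has $$\Phi^{\mathcal X}_{\Delta}(Z)=\big(\operatorname{Ass}^{-1}Z\cap\mathcal X,\ \operatorname{Ass}^{-1}(\Delta\setminus Z)\cap\mathcal X\big),$$ and the maps $\Phi^{\mathcal X}_{\Delta}:\operatorname{spcl}(\Delta)\to\operatorname{wtp}(\mathcal X)$ and $\Psi^{\mathcal X}_{\Delta}:\operatorname{wtp}(\mathcal X)\to\operatorname{spcl}(\Delta)$ are mutually inverse bijections. Therefore, there is a one-to-one correspondence between the specialization-closed subsets of $\operatorname{Ass}\mathcal X$ and the weak torsion pairs in $\mathcal X$.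
   Context: $\operatorname{mod} R$ is the category of finitely generated $R$-modules. All subcategories are full and closed under isomorphisms. $\operatorname{Ass}\mathcal X=\bigcup_{M\in\mathcal X}\operatorname{Ass}M$, $\operatorname{Supp}\mathcal X=\bigcup_{M\in\mathcal X}\operatorname{Supp}M$, and for $W\subseteq\operatorname{Spec}R$, $\operatorname{Ass}^{-1}W=\{M\in\operatorname{mod}R\mid\operatorname{Ass}M\subseteq W\}$. A subset $\Delta\subseteq\operatorname{Spec}R$ has the subspace topology from the Zariski topology; $\operatorname{spcl}(\Delta)$ is the set of specialization-closed subsets $Z$ of $\Delta$ (for each $z\in Z$ the closure of $\{z\}$ in $\Delta$ lies in $Z$). For subcategories $\mathcal D,\mathcal Y$ of $\operatorname{mod}R$, put $\mathcal D^\perp_{\mathcal Y}=\{Y\in\mathcal Y\mid\operatorname{Hom}_R(D,Y)=0\ \forall D\in\mathcal D\}$ and ${}^\perp_{\mathcal Y}\mathcal D=\{Y\in\mathcal Y\mid\operatorname{Hom}_R(Y,D)=0\ \forall D\in\mathcal D\}$. A pair $(\mathcal T,\mathcal F)$ of subcategories of $\mathcal Y$ is a weak torsion pair in $\mathcal Y$ if $\mathcal T^\perp_{\mathcal Y}=\mathcal F$ and ${}^\perp_{\mathcal Y}\mathcal F=\mathcal T$; $\operatorname{wtp}(\mathcal Y)$ is the set of these. For $\mathcal X\subseteq\operatorname{Ass}^{-1}\Delta$ the maps are defined as follows. For $Z\in\operatorname{spcl}\Delta$ let $\Phi_\Delta(Z)=(\operatorname{Ass}^{-1}Z,\operatorname{Ass}^{-1}(\Delta\setminus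 Z))$ (a weak torsion pair in $\operatorname{Ass}^{-1}\Delta$) and $\Phi^{\mathcal X}_\Delta(Z)=\big({}^\perp_{\mathcal X}(\mathcal T_0{}^\perp_{\mathcal X}),\mathcal T_0{}^\perp_{\mathcal X}\big)$ with $\mathcal T_0=\operatorname{Ass}^{-1}Z\cap\mathcal X$. For $(\mathcal T,\mathcal F)\in\operatorname{wtp}(\mathcal X)$ let $\Psi^{\mathcal X}_\Delta(\mathcal T,\mathcal F)=\Delta\cap\operatorname{Supp}\big({}^\perp_{\mathcal Y}(\mathcal T^\perp_{\mathcal Y})\big)$ with $\mathcal Y=\operatorname{Ass}^{-1}\Delta$. *)

theory Defs
  imports "HOL-Analysis.Abstract_Topology" "HOL-Algebra.Module" "HOL-Algebra.Ring_Divisibility"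
begin

section \<open>Finitely generated modules\<close>

text \<open>
  HOL has no type of all modules, so everything below takes place among the modules whose
  carrier lies in an arbitrary type \<open>'m\<close>. For \<open>'m\<close> = \<open>nat \<Rightarrow> 'a\<close> every
  finitely generated module is isomorphic to one of these
  (lemma \<open>mod_cat_universe\<close> below), and then the isomorphism-closed subsets of
  \<open>mod_cat R\<close> are exactly the (full, isomorphism-closed) subcategories of mod R.
\<close>

definition fin_gen_module :: "('a, 'r) ring_scheme \<Rightarrow> ('a, 'm) module \<Rightarrow> bool" where
  "fin_gen_module R M \<longleftrightarrow> module R M \<and>
     (\<exists>A. finite A \<and> A \<subseteq> carrier M \<and> (\<lambda>N. submodule N R M) hull A = carrier M)"

definition mod_cat :: "('a, 'r) ring_scheme \<Rightarrow> ('a, 'm) module set" where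
  "mod_cat R = {M. fin_gen_module R M}"

definition mod_hom ::
    "('a, 'r) ring_scheme \<Rightarrow> ('a, 'm) module \<Rightarrow> ('a, 'n) module \<Rightarrow> ('m \<Rightarrow> 'n) set" where
  "mod_hom R M N = {f \<in> hom (add_monoid M) (add_monoid N).
     \<forall>a\<in>carrier R. \<forall>x\<in>carrier M. f (a \<odot>\<^bsub>M\<^esub> x) = a \<odot>\<^bsub>N\<^esub> f x}"

text \<open>Homomorphisms are unrestricted outside the carrier, hence ``Hom = 0'' is tested on it.\<close>

definition Hom_zero ::
    "('a, 'r) ring_scheme \<Rightarrow> ('a, 'm) module \<Rightarrow> ('a, 'n) module \<Rightarrow> bool" where
  "Hom_zero R M N \<longleftrightarrow> (\<forall>f\<in>mod_hom R M N. \<forall>x\<in>carrier M. f x = \<zero>\<^bsub>N\<^esub>)"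

definition mod_iso ::
    "('a, 'r) ring_scheme \<Rightarrow> ('a, 'm) module \<Rightarrow> ('a, 'n) module \<Rightarrow> bool" where
  "mod_iso R M N \<longleftrightarrow> (\<exists>f\<in>mod_hom R M N. bij_betw f (carrier M) (carrier N))"

definition subcategory :: "('a, 'r) ring_scheme \<Rightarrow> ('a, 'm) module set \<Rightarrow> bool" where
  "subcategory R \<C> \<longleftrightarrow> \<C> \<subseteq> mod_cat R \<and>
     (\<forall>M\<in>\<C>. \<forall>N\<in>mod_cat R. mod_iso R M N \<longrightarrow> N \<in> \<C>)"


section \<open>Spectrum, associated primes and supports\<close>

definition Spec :: "('a, 'r) ring_scheme \<Rightarrow> 'a set set" where
  "Spec R = {p. primeideal p R}"

definition zariski :: "('a, 'r) ring_scheme \<Rightarrow> 'a set topology" where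
  "zariski R = topology (\<lambda>U. \<exists>I. ideal I R \<and> U = {p \<in> Spec R. \<not> I \<subseteq> p})"

definition spcl :: "('a, 'r) ring_scheme \<Rightarrow> 'a set set \<Rightarrow> 'a set set set" where
  "spcl R \<Delta> = {Z. Z \<subseteq> \<Delta> \<and> (\<forall>z\<in>Z. subtopology (zariski R) \<Delta> closure_of {z} \<subseteq> Z)}"

definition annihilator :: "('a, 'r) ring_scheme \<Rightarrow> ('a, 'm) module \<Rightarrow> 'm \<Rightarrow> 'a set" where
  "annihilator R M x = {a \<in> carrier R. a \<odot>\<^bsub>M\<^esub> x = \<zero>\<^bsub>M\<^esub>}"

definition Ass :: "('a, 'r) ring_scheme \<Rightarrow> ('a, 'm) module \<Rightarrow> 'a set set" where
  "Ass R M = {p \<in> Spec R. \<exists>x\<in>carrier M. p = annihilator R M x}"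

text \<open>The class of \<open>(x, s)\<close> under \<open>loc_rel R M p\<close> is the fraction \<open>x/s\<close>.\<close>

definition loc_rel ::
    "('a, 'r) ring_scheme \<Rightarrow> ('a, 'm) module \<Rightarrow> 'a set \<Rightarrow> (('m \<times> 'a) \<times> ('m \<times> 'a)) set" where
  "loc_rel R M p = {((x, s), (y, t)). x \<in> carrier M \<and> y \<in> carrier M \<and>
     s \<in> carrier R - p \<and> t \<in> carrier R - p \<and>
     (\<exists>u\<in>carrier R - p. u \<odot>\<^bsub>M\<^esub> (t \<odot>\<^bsub>M\<^esub> x) = u \<odot>\<^bsub>M\<^esub> (s \<odot>\<^bsub>M\<^esub> y))}"

definition localization ::
    "('a, 'r) ring_scheme \<Rightarrow> ('a, 'm) module \<Rightarrow> 'a set \<Rightarrow> ('m \<times> 'a) set set" where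
  "localization R M p = (carrier M \<times> (carrier R - p)) // loc_rel R M p"

definition loc_zero ::
    "('a, 'r) ring_scheme \<Rightarrow> ('a, 'm) module \<Rightarrow> 'a set \<Rightarrow> ('m \<times> 'a) set" where
  "loc_zero R M p = loc_rel R M p `` {(\<zero>\<^bsub>M\<^esub>, \<one>\<^bsub>R\<^esub>)}"

definition Supp :: "('a, 'r) ring_scheme \<Rightarrow> ('a, 'm) module \<Rightarrow> 'a set set" where
  "Supp R M = {p \<in> Spec R. localization R M p \<noteq> {loc_zero R M p}}"

definition Ass_cat :: "('a, 'r) ring_scheme \<Rightarrow> ('a, 'm) module set \<Rightarrow> 'a set set" where
  "Ass_cat R \<C> = (\<Union>M\<in>\<C>. Ass R M)"

definition Supp_cat :: "('a, 'r) ring_scheme \<Rightarrow> ('a, 'm) module set \<Rightarrow> 'a set set" where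
  "Supp_cat R \<C> = (\<Union>M\<in>\<C>. Supp R M)"

definition Ass_inv :: "('a, 'r) ring_scheme \<Rightarrow> 'a set set \<Rightarrow> ('a, 'm) module set" where
  "Ass_inv R W = {M \<in> mod_cat R. Ass R M \<subseteq> W}"


section \<open>Weak torsion pairs\<close>

text \<open>\<open>right_perp R \<U> \<D>\<close> is $\mathcal{D}^{\perp}_{\mathcal U}$ and \<open>left_perp R \<U> \<D>\<close> is ${}^{\perp}_{\mathcal U}\mathcal{D}$.\<close>

definition right_perp ::
    "('a, 'r) ring_scheme \<Rightarrow> ('a, 'm) module set \<Rightarrow> ('a, 'm) module set \<Rightarrow> ('a, 'm) module set" where
  "right_perp R \<U> \<D> = {M \<in> \<U>. \<forall>D\<in>\<D>. Hom_zero R D M}"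

definition left_perp ::
    "('a, 'r) ring_scheme \<Rightarrow> ('a, 'm) module set \<Rightarrow> ('a, 'm) module set \<Rightarrow> ('a, 'm) module set" where
  "left_perp R \<U> \<D> = {M \<in> \<U>. \<forall>D\<in>\<D>. Hom_zero R M D}"

definition wtp ::
    "('a, 'r) ring_scheme \<Rightarrow> ('a, 'm) module set \<Rightarrow>
     (('a, 'm) module set \<times> ('a, 'm) module set) set" where
  "wtp R \<U> = {(\<T>, \<F>). subcategory R \<T> \<and> subcategory R \<F> \<and> \<T> \<subseteq> \<U> \<and> \<F> \<subseteq> \<U> \<and>
     right_perp R \<U> \<T> = \<F> \<and> left_perp R \<U> \<F> = \<T>}"

text \<open>The set \<open>\<Delta>\<close> enters \<open>\<Phi>\<close> only through its domain, which is \<open>spcl R \<Delta>\<close>.\<close>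

definition Phi ::
    "('a, 'r) ring_scheme \<Rightarrow> ('a, 'm) module set \<Rightarrow> 'a set set \<Rightarrow>
     ('a, 'm) module set \<times> ('a, 'm) module set" where
  "Phi R \<C> Z = (let \<T>\<^sub>0 = Ass_inv R Z \<inter> \<C> in
     (left_perp R \<C> (right_perp R \<C> \<T>\<^sub>0), right_perp R \<C> \<T>\<^sub>0))"

text \<open>Dually, \<open>\<C>\<close> enters \<open>\<Psi>\<close> only through its domain, which is \<open>wtp R \<C>\<close>.\<close>

definition Psi ::
    "('a, 'r) ring_scheme \<Rightarrow> 'a set set \<Rightarrow>
     ('a, 'm) module set \<times> ('a, 'm) module set \<Rightarrow> 'a set set" where
  "Psi R \<Delta> = (\<lambda>(\<T>, \<F>). let \<U> = Ass_inv R \<Delta> in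
     \<Delta> \<inter> Supp_cat R (left_perp R \<U> (right_perp R \<U> \<T>)))"


section \<open>Well-definedness of the encodings\<close>

lemma istopology_zariski:
  assumes "cring R"
  shows "istopology (\<lambda>U. \<exists>I. ideal I R \<and> U = {p \<in> Spec R. \<not> I \<subseteq> p})"
proof -
  interpret cring R by fact
  show ?thesis
    unfolding istopology_def
  proof (intro conjI allI impI)
    fix S T
    assume "\<exists>I. ideal I R \<and> S = {p \<in> Spec R. \<not> I \<subseteq> p}"
      and "\<exists>I. ideal I R \<and> T = {p \<in> Spec R. \<not> I \<subseteq> p}"
    then obtain I J where I: "ideal I R" "S = {p \<in> Spec R. \<not> I \<subseteq> p}"
      and J: "ideal J R" "T = {p \<in> Spec R. \<not> J \<subseteq> p}" by blast
    have IJ: "ideal (I \<inter> J) R" using I J by (simp add: i_intersect)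
    have "\<not> I \<inter> J \<subseteq> p" if p: "primeideal p R" and np: "\<not> I \<subseteq> p" "\<not> J \<subseteq> p" for p
    proof -
      obtain a b where ab: "a \<in> I" "a \<notin> p" "b \<in> J" "b \<notin> p" using np by blast
      have c: "a \<in> carrier R" "b \<in> carrier R"
        using ideal.Icarr[OF I(1)] ideal.Icarr[OF J(1)] ab by simp_all
      have "a \<otimes>\<^bsub>R\<^esub> b \<in> I \<inter> J"
        using ideal.I_r_closed[OF I(1)] ideal.I_l_closed[OF J(1)] ab c by simp
      moreover have "a \<otimes>\<^bsub>R\<^esub> b \<notin> p" using primeideal.I_prime[OF p c] ab by blast
      ultimately show ?thesis by blast
    qed
    then have "S \<inter> T = {p \<in> Spec R. \<not> I \<inter> J \<subseteq> p}"
      unfolding I J Spec_def by blast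
    then show "\<exists>I. ideal I R \<and> S \<inter> T = {p \<in> Spec R. \<not> I \<subseteq> p}" using IJ by blast
  next
    fix \<K>
    assume *: "\<forall>K\<in>\<K>. \<exists>I. ideal I R \<and> K = {p \<in> Spec R. \<not> I \<subseteq> p}"
    then obtain f where f: "\<And>K. K \<in> \<K> \<Longrightarrow> ideal (f K) R \<and> K = {p \<in> Spec R. \<not> f K \<subseteq> p}"
      by metis
    let ?A = "\<Union>K\<in>\<K>. f K"
    have A: "?A \<subseteq> carrier R" using f by (auto dest: ideal.Icarr)
    have "Idl\<^bsub>R\<^esub> ?A \<subseteq> p \<longleftrightarrow> ?A \<subseteq> p" if "p \<in> Spec R" for p
      using that A Idl_subset_ideal[of p ?A] by (simp add: Spec_def primeideal_def)
    then have "{p \<in> Spec R. \<not> Idl\<^bsub>R\<^esub> ?A \<subseteq> p} = {p \<in> Spec R. \<not> ?A \<subseteq> p}" by blast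
    also have "\<dots> = (\<Union>K\<in>\<K>. {p \<in> Spec R. \<not> f K \<subseteq> p})" by blast
    also have "\<dots> = \<Union>\<K>" using f by simp
    finally have "\<Union>\<K> = {p \<in> Spec R. \<not> Idl\<^bsub>R\<^esub> ?A \<subseteq> p}" by simp
    then show "\<exists>I. ideal I R \<and> \<Union>\<K> = {p \<in> Spec R. \<not> I \<subseteq> p}"
      using genideal_ideal[OF A] by blast
  qed
qed

lemma openin_zariski:
  assumes "cring R"
  shows "openin (zariski R) U \<longleftrightarrow> (\<exists>I. ideal I R \<and> U = {p \<in> Spec R. \<not> I \<subseteq> p})"
  using istopology_zariski[OF assms] by (simp add: zariski_def)

lemma equiv_loc_rel:
  assumes "module R M" and "primeideal p R"
  shows "equiv (carrier M \<times> (carrier R - p)) (loc_rel R M p)"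
proof -
  interpret module R M by fact
  interpret p: primeideal p R by fact
  have one: "\<one>\<^bsub>R\<^esub> \<in> carrier R - p" using p.one_imp_carrier p.I_notcarr by blast
  have mul: "a \<otimes>\<^bsub>R\<^esub> b \<in> carrier R - p" if "a \<in> carrier R - p" "b \<in> carrier R - p" for a b
    using that p.I_prime by blast
  show ?thesis
  proof (rule equivI)
    show "loc_rel R M p \<subseteq> (carrier M \<times> (carrier R - p)) \<times> (carrier M \<times> (carrier R - p))"
      unfolding loc_rel_def by auto
    show "refl_on (carrier M \<times> (carrier R - p)) (loc_rel R M p)"
      using one unfolding refl_on_def loc_rel_def by auto
    show "sym (loc_rel R M p)"
    proof (rule symI, clarify)
      fix x s y t assume "((x, s), (y, t)) \<in> loc_rel R M p"
      then show "((y, t), (x, s)) \<in> loc_rel R M p"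
        unfolding loc_rel_def by (auto dest: sym)
    qed
    show "trans (loc_rel R M p)"
    proof (rule transI, clarify)
      fix x s y t z r
      assume "((x, s), (y, t)) \<in> loc_rel R M p" "((y, t), (z, r)) \<in> loc_rel R M p"
      then obtain u v where c: "x \<in> carrier M" "y \<in> carrier M" "z \<in> carrier M"
          "s \<in> carrier R - p" "t \<in> carrier R - p" "r \<in> carrier R - p"
          "u \<in> carrier R - p" "v \<in> carrier R - p"
        and e1: "u \<odot>\<^bsub>M\<^esub> (t \<odot>\<^bsub>M\<^esub> x) = u \<odot>\<^bsub>M\<^esub> (s \<odot>\<^bsub>M\<^esub> y)"
        and e2: "v \<odot>\<^bsub>M\<^esub> (r \<odot>\<^bsub>M\<^esub> y) = v \<odot>\<^bsub>M\<^esub> (t \<odot>\<^bsub>M\<^esub> z)"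
        unfolding loc_rel_def by auto
      let ?w = "u \<otimes>\<^bsub>R\<^esub> v \<otimes>\<^bsub>R\<^esub> t"
      have w: "?w \<in> carrier R - p" using c mul by blast
      have "?w \<odot>\<^bsub>M\<^esub> (r \<odot>\<^bsub>M\<^esub> x) = v \<odot>\<^bsub>M\<^esub> (r \<odot>\<^bsub>M\<^esub> (u \<odot>\<^bsub>M\<^esub> (t \<odot>\<^bsub>M\<^esub> x)))"
        using c by (simp add: smult_assoc1[symmetric] R.m_ac)
      also have "\<dots> = v \<odot>\<^bsub>M\<^esub> (r \<odot>\<^bsub>M\<^esub> (u \<odot>\<^bsub>M\<^esub> (s \<odot>\<^bsub>M\<^esub> y)))" using e1 by simp
      also have "\<dots> = u \<odot>\<^bsub>M\<^esub> (s \<odot>\<^bsub>M\<^esub> (v \<odot>\<^bsub>M\<^esub> (r \<odot>\<^bsub>M\<^esub> y)))"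
        using c by (simp add: smult_assoc1[symmetric] R.m_ac)
      also have "\<dots> = u \<odot>\<^bsub>M\<^esub> (s \<odot>\<^bsub>M\<^esub> (v \<odot>\<^bsub>M\<^esub> (t \<odot>\<^bsub>M\<^esub> z)))" using e2 by simp
      also have "\<dots> = ?w \<odot>\<^bsub>M\<^esub> (s \<odot>\<^bsub>M\<^esub> z)"
        using c by (simp add: smult_assoc1[symmetric] R.m_ac)
      finally show "((x, s), (z, r)) \<in> loc_rel R M p"
        using w c unfolding loc_rel_def by auto
    qed
  qed
qed

lemma fin_gen_coefficients:
  assumes "fin_gen_module R M"
  shows "\<exists>(n :: nat) g. g \<in> {..<n} \<rightarrow> carrier M \<and>
    (\<forall>x\<in>carrier M. \<exists>c \<in> {..<n} \<rightarrow> carrier R. x = (\<Oplus>\<^bsub>M\<^esub>i\<in>{..<n}. c i \<odot>\<^bsub>M\<^esub> g i))"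
proof -
  interpret module R M using assms unfolding fin_gen_module_def by blast
  obtain A where A: "finite A" "A \<subseteq> carrier M" "(\<lambda>N. submodule N R M) hull A = carrier M"
    using assms unfolding fin_gen_module_def by blast
  obtain n :: nat and g where g: "A = g ` {..<n}"
    using A(1) by (metis finite_conv_nat_seg_image lessThan_def)
  have gc: "g \<in> {..<n} \<rightarrow> carrier M" using g A by auto
  define l where "l c = (\<Oplus>\<^bsub>M\<^esub>i\<in>{..<n}. c i \<odot>\<^bsub>M\<^esub> g i)" for c
  let ?C = "{..<n} \<rightarrow> carrier R"
  have fc: "(\<lambda>i. c i \<odot>\<^bsub>M\<^esub> g i) \<in> {..<n} \<rightarrow> carrier M" if "c \<in> ?C" for c
    using that gc by (auto simp: Pi_iff)
  have lc: "l c \<in> carrier M" if "c \<in> ?C" for c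
    unfolding l_def using fc[OF that] by (rule M.finsum_closed)
  have ladd: "l c \<oplus>\<^bsub>M\<^esub> l d = l (\<lambda>i. c i \<oplus>\<^bsub>R\<^esub> d i)" if c: "c \<in> ?C" and d: "d \<in> ?C" for c d
  proof -
    have "l c \<oplus>\<^bsub>M\<^esub> l d = (\<Oplus>\<^bsub>M\<^esub>i\<in>{..<n}. c i \<odot>\<^bsub>M\<^esub> g i \<oplus>\<^bsub>M\<^esub> d i \<odot>\<^bsub>M\<^esub> g i)"
      unfolding l_def using M.finsum_addf[OF fc[OF c] fc[OF d]] by simp
    also have "\<dots> = l (\<lambda>i. c i \<oplus>\<^bsub>R\<^esub> d i)"
      unfolding l_def using c d gc by (intro M.finsum_cong') (auto simp: smult_l_distr Pi_iff)
    finally show ?thesis .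
  qed
  have lsm: "a \<odot>\<^bsub>M\<^esub> l c = l (\<lambda>i. a \<otimes>\<^bsub>R\<^esub> c i)" if c: "c \<in> ?C" and a: "a \<in> carrier R" for a c
  proof -
    have "a \<odot>\<^bsub>M\<^esub> l c = (\<Oplus>\<^bsub>M\<^esub>i\<in>{..<n}. a \<odot>\<^bsub>M\<^esub> (c i \<odot>\<^bsub>M\<^esub> g i))"
      unfolding l_def using finsum_smult_ldistr[OF _ a fc[OF c]] by simp
    also have "\<dots> = l (\<lambda>i. a \<otimes>\<^bsub>R\<^esub> c i)"
      unfolding l_def using a c gc by (intro M.finsum_cong') (auto simp: smult_assoc1 Pi_iff)
    finally show ?thesis .
  qed
  have "submodule (l ` ?C) R M"
  proof (rule submoduleI)
    show "l ` ?C \<subseteq> carrier M" using lc by blast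
    have z: "(\<lambda>i. \<zero>\<^bsub>R\<^esub>) \<in> ?C" by simp
    have "\<zero>\<^bsub>R\<^esub> \<odot>\<^bsub>M\<^esub> l (\<lambda>i. \<zero>\<^bsub>R\<^esub>) = l (\<lambda>i. \<zero>\<^bsub>R\<^esub>)" using lsm[OF z, of "\<zero>\<^bsub>R\<^esub>"] by simp
    then have "l (\<lambda>i. \<zero>\<^bsub>R\<^esub>) = \<zero>\<^bsub>M\<^esub>" using lc[OF z] by simp
    then show "\<zero>\<^bsub>M\<^esub> \<in> l ` ?C" using z by force
    show "a \<oplus>\<^bsub>M\<^esub> b \<in> l ` ?C" if ab: "a \<in> l ` ?C" "b \<in> l ` ?C" for a b
    proof -
      obtain c d where cd: "c \<in> ?C" "d \<in> ?C" "a = l c" "b = l d" using ab by blast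
      have "(\<lambda>i. c i \<oplus>\<^bsub>R\<^esub> d i) \<in> ?C" using cd by (auto simp: Pi_iff)
      then show ?thesis using ladd cd by auto
    qed
    show sm: "a \<odot>\<^bsub>M\<^esub> x \<in> l ` ?C" if ax: "a \<in> carrier R" "x \<in> l ` ?C" for a x
    proof -
      obtain c where c: "c \<in> ?C" "x = l c" using ax by blast
      have "(\<lambda>i. a \<otimes>\<^bsub>R\<^esub> c i) \<in> ?C" using c that by (auto simp: Pi_iff)
      then show ?thesis using lsm c that by auto
    qed
    show "\<ominus>\<^bsub>M\<^esub> a \<in> l ` ?C" if "a \<in> l ` ?C" for a
    proof -
      have "a \<in> carrier M" using that lc by blast
      then have "\<ominus>\<^bsub>M\<^esub> a = (\<ominus>\<^bsub>R\<^esub> \<one>\<^bsub>R\<^esub>) \<odot>\<^bsub>M\<^esub> a" by (simp add: smult_l_minus)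
      then show ?thesis using sm[of "\<ominus>\<^bsub>R\<^esub> \<one>\<^bsub>R\<^esub>" a] that by simp
    qed
  qed
  moreover have "A \<subseteq> l ` ?C"
  proof
    fix y assume "y \<in> A"
    then obtain j where j: "j < n" "y = g j" using g by auto
    have "l (\<lambda>i. if i = j then \<one>\<^bsub>R\<^esub> else \<zero>\<^bsub>R\<^esub>) =
        (\<Oplus>\<^bsub>M\<^esub>i\<in>{..<n}. if j = i then g i else \<zero>\<^bsub>M\<^esub>)"
      unfolding l_def using gc by (intro M.finsum_cong') (auto simp: Pi_iff)
    also have "\<dots> = g j" using M.finsum_singleton[of j "{..<n}" g] j gc by simp
    finally have y: "y = l (\<lambda>i. if i = j then \<one>\<^bsub>R\<^esub> else \<zero>\<^bsub>R\<^esub>)" using j by simp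
    show "y \<in> l ` ?C" unfolding y by (rule imageI) auto
  qed
  ultimately have "carrier M \<subseteq> l ` ?C" using A(3) unfolding hull_def by blast
  then have "\<forall>x\<in>carrier M. \<exists>c\<in>?C. x = l c" by blast
  then show ?thesis
    using gc unfolding l_def by (intro exI[of _ n] exI[of _ g] conjI)
qed

lemma fin_gen_module_iso:
  assumes M: "fin_gen_module R M" and N: "module R N" and f: "f \<in> mod_hom R M N"
    and bij: "bij_betw f (carrier M) (carrier N)"
  shows "fin_gen_module R N"
proof -
  interpret M: module R M using M unfolding fin_gen_module_def by blast
  interpret N: module R N by fact
  have fadd: "f (x \<oplus>\<^bsub>M\<^esub> y) = f x \<oplus>\<^bsub>N\<^esub> f y" if "x \<in> carrier M" "y \<in> carrier M" for x y
    using f that unfolding mod_hom_def hom_def by simp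
  have fsm: "f (a \<odot>\<^bsub>M\<^esub> x) = a \<odot>\<^bsub>N\<^esub> f x" if "a \<in> carrier R" "x \<in> carrier M" for a x
    using f that unfolding mod_hom_def by blast
  have f0: "f \<zero>\<^bsub>M\<^esub> = \<zero>\<^bsub>N\<^esub>"
    using fsm[of "\<zero>\<^bsub>R\<^esub>" "\<zero>\<^bsub>M\<^esub>"] bij_betwE[OF bij] by simp
  obtain A where A: "finite A" "A \<subseteq> carrier M" "(\<lambda>N. submodule N R M) hull A = carrier M"
    using M unfolding fin_gen_module_def by blast
  have "carrier N \<subseteq> H" if H: "submodule H R N" "f ` A \<subseteq> H" for H
  proof -
    note HE = N.submoduleE[OF H(1)]
    have "submodule {x \<in> carrier M. f x \<in> H} R M"
    proof (rule M.submoduleI)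
      show sm: "a \<odot>\<^bsub>M\<^esub> x \<in> {x \<in> carrier M. f x \<in> H}"
        if "a \<in> carrier R" "x \<in> {x \<in> carrier M. f x \<in> H}" for a x
        using that fsm HE(4) by auto
      show "\<zero>\<^bsub>M\<^esub> \<in> {x \<in> carrier M. f x \<in> H}"
        using f0 HE(2) HE(4)[of "\<zero>\<^bsub>R\<^esub>"] HE(1) N.smult_l_null by fastforce
      show "\<ominus>\<^bsub>M\<^esub> a \<in> {x \<in> carrier M. f x \<in> H}" if "a \<in> {x \<in> carrier M. f x \<in> H}" for a
        using sm[of "\<ominus>\<^bsub>R\<^esub> \<one>\<^bsub>R\<^esub>" a] that by (simp add: M.smult_l_minus)
    qed (use fadd HE(5) in auto)
    then have "carrier M \<subseteq> {x \<in> carrier M. f x \<in> H}" using A H unfolding hull_def by blast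
    then have "f ` carrier M \<subseteq> H" by auto
    then show ?thesis using bij_betw_imp_surj_on[OF bij] by simp
  qed
  moreover have "f ` A \<subseteq> carrier N" using A(2) bij_betwE[OF bij] by blast
  ultimately have "(\<lambda>H. submodule H R N) hull (f ` A) = carrier N"
    using N.carrier_is_submodule unfolding hull_def by (intro equalityI Inter_lower Inter_greatest) auto
  then show ?thesis
    using \<open>f ` A \<subseteq> carrier N\<close> A(1) N unfolding fin_gen_module_def by (intro conjI exI[of _ "f ` A"]) auto
qed

lemma mod_cat_universe:
  fixes R :: "('a, 'r) ring_scheme" and M :: "('a, 'm) module"
  assumes M: "fin_gen_module R M"
  shows "\<exists>N :: ('a, nat \<Rightarrow> 'a) module. N \<in> mod_cat R \<and> mod_iso R M N"
proof -
  interpret M: module R M using M unfolding fin_gen_module_def by blast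
  obtain n :: nat and g where ex:
    "\<forall>x\<in>carrier M. \<exists>c \<in> {..<n} \<rightarrow> carrier R. x = (\<Oplus>\<^bsub>M\<^esub>i\<in>{..<n}. c i \<odot>\<^bsub>M\<^esub> g i)"
    using fin_gen_coefficients[OF M] by (elim exE conjE)
  define l where "l c = (\<Oplus>\<^bsub>M\<^esub>i\<in>{..<n}. c i \<odot>\<^bsub>M\<^esub> g i)" for c
  define h where "h x = (SOME c. x = l c)" for x
  have h: "l (h x) = x" if "x \<in> carrier M" for x
  proof -
    have "\<exists>c. x = l c" using bspec[OF ex that] unfolding l_def by auto
    then have "x = l (h x)" unfolding h_def by (rule someI_ex)
    then show ?thesis by simp
  qed
  have inj: "inj_on h (carrier M)" by (rule inj_on_inverseI[of _ l]) (rule h)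
  define k where "k = inv_into (carrier M) h"
  have kh [simp]: "k (h x) = x" if "x \<in> carrier M" for x
    using inj that unfolding k_def by simp
  define N :: "('a, nat \<Rightarrow> 'a) module" where
    "N = \<lparr>carrier = h ` carrier M, mult = undefined, one = undefined, zero = h \<zero>\<^bsub>M\<^esub>,
      add = (\<lambda>u v. h (k u \<oplus>\<^bsub>M\<^esub> k v)), smult = (\<lambda>a u. h (a \<odot>\<^bsub>M\<^esub> k u))\<rparr>"
  have "abelian_group N"
  proof (rule abelian_groupI)
    fix x assume "x \<in> carrier N"
    then obtain u where u: "u \<in> carrier M" "x = h u" unfolding N_def by auto
    have "h (\<ominus>\<^bsub>M\<^esub> u) \<in> carrier N" "h (\<ominus>\<^bsub>M\<^esub> u) \<oplus>\<^bsub>N\<^esub> x = \<zero>\<^bsub>N\<^esub>"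
      using u by (auto simp: N_def M.l_neg)
    then show "\<exists>y\<in>carrier N. y \<oplus>\<^bsub>N\<^esub> x = \<zero>\<^bsub>N\<^esub>" by blast
  qed (auto simp: N_def M.a_ac)
  then have N: "module R N"
    by (intro moduleI) (auto simp: N_def M.smult_l_distr M.smult_r_distr M.smult_assoc1 M.is_cring)
  have hom: "h \<in> mod_hom R M N" unfolding mod_hom_def hom_def N_def by auto
  have bij: "bij_betw h (carrier M) (carrier N)" using inj unfolding N_def bij_betw_def by simp
  show ?thesis
    using fin_gen_module_iso[OF M N hom bij] hom bij unfolding mod_cat_def mod_iso_def by blast
qed

end

theory Submission
  imports Defs
begin

text \<open>
  Everything rests on one fact about a noetherian ring \<open>R\<close>: for a finitely generated module \<open>M\<close>,
  \<open>Hom(M, N) = 0\<close> if and only if \<open>Supp M\<close> and \<open>Ass N\<close> are disjoint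
  (\<open>Hom_zero_iff_Supp_Ass_disjoint\<close>). It turns perpendicular categories into conditions on sets of
  primes: \<open>M\<close> is in the right perpendicular of \<open>\<T>\<close> when \<open>Ass M\<close> avoids \<open>Supp \<T>\<close>, and in the left
  perpendicular of \<open>\<F>\<close> when \<open>Supp M\<close> avoids \<open>Ass \<F>\<close>.

  Let \<open>Z\<close> be specialization-closed in \<open>\<Delta>\<close>. Every prime in a support contains an associated prime
  (\<open>Supp_above_Ass\<close>), so \<open>Ass M \<subseteq> Z\<close> forces \<open>\<Delta> \<inter> Supp M \<subseteq> Z\<close>. Together with the modules that have a
  single associated prime \<open>p\<close>, for all \<open>p \<in> \<Delta>\<close>, this shows that the modules with associated primes
  in \<open>Z\<close> and those with associated primes in \<open>\<Delta> - Z\<close> are each other's perpendiculars, and that \<open>Z\<close>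
  is recovered as \<open>\<Delta> \<inter> Supp\<close> of the former. The same computation is valid in \<open>\<C>\<close> and in the bigger
  category of all modules with associated primes in \<open>\<Delta>\<close>, which is why \<open>Psi\<close> undoes \<open>Phi\<close>.
  Conversely, the torsion-free part of a weak torsion pair \<open>(\<T>, \<F>)\<close> depends only on
  \<open>W = \<Delta> \<inter> Supp \<T>\<close>, which is specialization-closed; hence the pair is the image of \<open>W\<close> under
  \<open>Phi\<close>.

  For the implication from \<open>p \<in> Supp M \<inter> Ass N\<close> to \<open>Hom(M, N) \<noteq> 0\<close>, no localized modules or residue
  fields are formed. A generator \<open>a\<close> of \<open>M\<close> is found whose class in a suitable quotient \<open>M/K\<close> generates
  \<open>M/K\<close> at \<open>p\<close> and has its annihilator in \<open>p\<close> (\<open>exists_local_cyclic_quotient\<close>). Clearing a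
  denominator \<open>s \<notin> p\<close> then gives a homomorphism from \<open>M\<close> to a copy of \<open>R/p\<close> inside \<open>N\<close>.
\<close>

section \<open>Submodules and spans\<close>

lemma (in module) submoduleI_no_inv:
  assumes "H \<subseteq> carrier M" and "\<zero>\<^bsub>M\<^esub> \<in> H"
    and "\<And>x y. x \<in> H \<Longrightarrow> y \<in> H \<Longrightarrow> x \<oplus>\<^bsub>M\<^esub> y \<in> H"
    and smult: "\<And>a x. a \<in> carrier R \<Longrightarrow> x \<in> H \<Longrightarrow> a \<odot>\<^bsub>M\<^esub> x \<in> H"
  shows "submodule H R M"
proof (rule submoduleI)
  show "\<ominus>\<^bsub>M\<^esub> x \<in> H" if "x \<in> H" for x
    using smult[of "\<ominus>\<^bsub>R\<^esub> \<one>\<^bsub>R\<^esub>" x] that assms(1) by (auto simp: smult_l_minus)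
qed (use assms in auto)

lemma (in module) smult_left_commute:
  assumes "a \<in> carrier R" "b \<in> carrier R" "x \<in> carrier M"
  shows "a \<odot>\<^bsub>M\<^esub> (b \<odot>\<^bsub>M\<^esub> x) = b \<odot>\<^bsub>M\<^esub> (a \<odot>\<^bsub>M\<^esub> x)"
  using assms R.m_comm[of a b] by (simp flip: smult_assoc1)

lemma (in module) submodule_zero:
  assumes "submodule H R M"
  shows "\<zero>\<^bsub>M\<^esub> \<in> H"
proof -
  obtain x where x: "x \<in> H" using submoduleE(2)[OF assms] by blast
  then show ?thesis
    using submoduleE(1,4)[OF assms] smult_l_null R.zero_closed by fastforce
qed

lemma (in module) submodule_zero_set: "submodule {\<zero>\<^bsub>M\<^esub>} R M"
  by (rule submoduleI_no_inv) auto

abbreviation span_of :: "('a, 'r) ring_scheme \<Rightarrow> ('a, 'm, 'k) module_scheme \<Rightarrow> 'm set \<Rightarrow> 'm set" where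
  "span_of R M A \<equiv> (\<lambda>N. submodule N R M) hull A"

lemma (in module) span_of_submodule:
  assumes "A \<subseteq> carrier M"
  shows "submodule (span_of R M A) R M"
proof (rule submoduleI_no_inv)
  show "span_of R M A \<subseteq> carrier M"
    using assms carrier_is_submodule by (simp add: hull_minimal)
qed (auto simp: hull_def submodule_zero submoduleE)

text \<open>If \<open>K\<close> is a submodule, then so is \<open>R a + K\<close>; hence it contains the span of
  \<open>K \<union> {a}\<close>.\<close>

lemma (in module) span_of_insert:
  assumes B: "B \<subseteq> carrier M" and a: "a \<in> carrier M" and x: "x \<in> span_of R M (insert a B)"
  shows "\<exists>r\<in>carrier R. \<exists>k\<in>span_of R M B. x = r \<odot>\<^bsub>M\<^esub> a \<oplus>\<^bsub>M\<^esub> k"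
proof -
  let ?K = "span_of R M B"
  let ?H = "{x. \<exists>r\<in>carrier R. \<exists>k\<in>?K. x = r \<odot>\<^bsub>M\<^esub> a \<oplus>\<^bsub>M\<^esub> k}"
  note K = span_of_submodule[OF B] submodule_zero[OF span_of_submodule[OF B]]
  note KE = submoduleE[OF K(1)]
  have kc: "k \<in> carrier M" if "k \<in> ?K" for k using KE(1) that by blast
  have "submodule ?H R M"
  proof (rule submoduleI_no_inv)
    show "?H \<subseteq> carrier M" using a kc by auto
    have "\<zero>\<^bsub>M\<^esub> = \<zero>\<^bsub>R\<^esub> \<odot>\<^bsub>M\<^esub> a \<oplus>\<^bsub>M\<^esub> \<zero>\<^bsub>M\<^esub>" using a by simp
    then show "\<zero>\<^bsub>M\<^esub> \<in> ?H" using K(2) by blast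
  next
    fix x y assume "x \<in> ?H" "y \<in> ?H"
    then obtain r k r' k' where *: "r \<in> carrier R" "k \<in> ?K" "x = r \<odot>\<^bsub>M\<^esub> a \<oplus>\<^bsub>M\<^esub> k"
      "r' \<in> carrier R" "k' \<in> ?K" "y = r' \<odot>\<^bsub>M\<^esub> a \<oplus>\<^bsub>M\<^esub> k'" by blast
    then have "x \<oplus>\<^bsub>M\<^esub> y = (r \<oplus>\<^bsub>R\<^esub> r') \<odot>\<^bsub>M\<^esub> a \<oplus>\<^bsub>M\<^esub> (k \<oplus>\<^bsub>M\<^esub> k')"
      using a kc by (simp add: smult_l_distr M.a_ac)
    then show "x \<oplus>\<^bsub>M\<^esub> y \<in> ?H" using * KE(5) R.add.m_closed by blast
  next
    fix c x assume c: "c \<in> carrier R" and "x \<in> ?H"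
    then obtain r k where *: "r \<in> carrier R" "k \<in> ?K" "x = r \<odot>\<^bsub>M\<^esub> a \<oplus>\<^bsub>M\<^esub> k" by blast
    then have "c \<odot>\<^bsub>M\<^esub> x = (c \<otimes>\<^bsub>R\<^esub> r) \<odot>\<^bsub>M\<^esub> a \<oplus>\<^bsub>M\<^esub> c \<odot>\<^bsub>M\<^esub> k"
      using a kc c by (simp add: smult_r_distr smult_assoc1)
    then show "c \<odot>\<^bsub>M\<^esub> x \<in> ?H" using * c KE(4) R.m_closed by blast
  qed
  moreover have "insert a B \<subseteq> ?H"
  proof -
    have "a = \<one>\<^bsub>R\<^esub> \<odot>\<^bsub>M\<^esub> a \<oplus>\<^bsub>M\<^esub> \<zero>\<^bsub>M\<^esub>" using a by simp
    then have "a \<in> ?H" using K(2) by blast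
    moreover have "b \<in> ?H" if "b \<in> B" for b
    proof -
      have b: "b \<in> ?K" using that by (rule hull_inc)
      moreover have "b = \<zero>\<^bsub>R\<^esub> \<odot>\<^bsub>M\<^esub> a \<oplus>\<^bsub>M\<^esub> b" using a kc[OF b] by simp
      ultimately show ?thesis by blast
    qed
    ultimately show ?thesis by blast
  qed
  ultimately have "span_of R M (insert a B) \<subseteq> ?H" by (simp add: hull_minimal)
  then show ?thesis using x by blast
qed

text \<open>The elements that \<open>s\<close> multiplies into \<open>H\<close> form a submodule.\<close>

lemma (in module) smult_span_of_subset:
  assumes H: "submodule H R M" and A: "A \<subseteq> carrier M" and s: "s \<in> carrier R"
    and sA: "\<And>x. x \<in> A \<Longrightarrow> s \<odot>\<^bsub>M\<^esub> x \<in> H" and x: "x \<in> span_of R M A"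
  shows "s \<odot>\<^bsub>M\<^esub> x \<in> H"
proof -
  note HE = submoduleE[OF H]
  have "submodule {x \<in> carrier M. s \<odot>\<^bsub>M\<^esub> x \<in> H} R M"
  proof (rule submoduleI_no_inv)
    fix c x assume *: "c \<in> carrier R" "x \<in> {x \<in> carrier M. s \<odot>\<^bsub>M\<^esub> x \<in> H}"
    then have "s \<odot>\<^bsub>M\<^esub> (c \<odot>\<^bsub>M\<^esub> x) = c \<odot>\<^bsub>M\<^esub> (s \<odot>\<^bsub>M\<^esub> x)"
      using s smult_left_commute[of s c x] by simp
    then show "c \<odot>\<^bsub>M\<^esub> x \<in> {x \<in> carrier M. s \<odot>\<^bsub>M\<^esub> x \<in> H}" using * HE(4) by simp
  qed (use s HE submodule_zero[OF H] in \<open>auto simp: smult_r_distr\<close>)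
  then have "span_of R M A \<subseteq> {x \<in> carrier M. s \<odot>\<^bsub>M\<^esub> x \<in> H}"
    using sA A by (intro hull_minimal) auto
  then show ?thesis using x by blast
qed

section \<open>Associated primes and supports\<close>

lemma SpecD:
  assumes "p \<in> Spec R"
  shows "primeideal p R" "\<one>\<^bsub>R\<^esub> \<in> carrier R - p"
    "\<And>s t. s \<in> carrier R - p \<Longrightarrow> t \<in> carrier R - p \<Longrightarrow> s \<otimes>\<^bsub>R\<^esub> t \<in> carrier R - p"
proof -
  show p: "primeideal p R" using assms by (simp add: Spec_def)
  interpret p: primeideal p R by (rule p)
  show "\<one>\<^bsub>R\<^esub> \<in> carrier R - p" using p.one_imp_carrier p.I_notcarr by blast
  show "s \<otimes>\<^bsub>R\<^esub> t \<in> carrier R - p" if "s \<in> carrier R - p" "t \<in> carrier R - p" for s t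
    using that p.I_prime by blast
qed

context
  fixes R :: "('a, 'r) ring_scheme" and M :: "('a, 'm) module"
  assumes M: "module R M"
begin

interpretation module R M by (rule M)

lemma annihilator_ideal:
  assumes x: "x \<in> carrier M"
  shows "ideal (annihilator R M x) R"
proof (rule idealI)
  show "ring R" by (rule R.ring_axioms)
  show "subgroup (annihilator R M x) (add_monoid R)"
  proof (rule R.add.subgroupI)
    show "annihilator R M x \<noteq> {}" using x unfolding annihilator_def by fastforce
    show "\<ominus>\<^bsub>R\<^esub> a \<in> annihilator R M x" if "a \<in> annihilator R M x" for a
      using that x smult_l_minus[of a x] unfolding annihilator_def by auto
  qed (use x in \<open>auto simp: annihilator_def smult_l_distr\<close>)
  fix a b assume a: "a \<in> annihilator R M x" and b: "b \<in> carrier R"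
  then show "b \<otimes>\<^bsub>R\<^esub> a \<in> annihilator R M x" using x by (simp add: annihilator_def smult_assoc1)
  then show "a \<otimes>\<^bsub>R\<^esub> b \<in> annihilator R M x"
    using a b R.m_comm[of a b] by (simp add: annihilator_def)
qed

text \<open>A fraction \<open>x/s\<close> is nonzero exactly when no element outside \<open>p\<close> kills its numerator.\<close>

lemma Supp_iff:
  assumes p: "p \<in> Spec R"
  shows "p \<in> Supp R M \<longleftrightarrow> (\<exists>x\<in>carrier M. annihilator R M x \<subseteq> p)"
proof -
  let ?A = "carrier M \<times> (carrier R - p)"
  note pD = SpecD[OF p]
  have eq: "equiv ?A (loc_rel R M p)" by (rule equiv_loc_rel[OF module_axioms pD(1)])
  have z: "(\<zero>\<^bsub>M\<^esub>, \<one>\<^bsub>R\<^esub>) \<in> ?A" using pD(2) by simp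
  have cls: "loc_rel R M p `` {(x, s)} = loc_zero R M p \<longleftrightarrow> (\<exists>u\<in>carrier R - p. u \<odot>\<^bsub>M\<^esub> x = \<zero>\<^bsub>M\<^esub>)"
    if xs: "(x, s) \<in> ?A" for x s
  proof -
    have "loc_rel R M p `` {(x, s)} = loc_zero R M p \<longleftrightarrow> ((x, s), (\<zero>\<^bsub>M\<^esub>, \<one>\<^bsub>R\<^esub>)) \<in> loc_rel R M p"
      unfolding loc_zero_def using eq_equiv_class_iff[OF eq xs z] .
    also have "\<dots> \<longleftrightarrow> (\<exists>u\<in>carrier R - p. u \<odot>\<^bsub>M\<^esub> x = \<zero>\<^bsub>M\<^esub>)"
      using xs pD(2) unfolding loc_rel_def by auto
    finally show ?thesis .
  qed
  let ?tors = "\<forall>x\<in>carrier M. \<exists>u\<in>carrier R - p. u \<odot>\<^bsub>M\<^esub> x = \<zero>\<^bsub>M\<^esub>"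
  have loc: "localization R M p = (\<lambda>v. loc_rel R M p `` {v}) ` ?A"
    unfolding localization_def quotient_def by blast
  have "localization R M p = {loc_zero R M p} \<longleftrightarrow> ?tors"
  proof
    assume triv: "localization R M p = {loc_zero R M p}"
    show ?tors
    proof
      fix x assume "x \<in> carrier M"
      then have x: "(x, \<one>\<^bsub>R\<^esub>) \<in> ?A" using pD(2) by simp
      then have "loc_rel R M p `` {(x, \<one>\<^bsub>R\<^esub>)} \<in> localization R M p" unfolding loc by (rule imageI)
      then show "\<exists>u\<in>carrier R - p. u \<odot>\<^bsub>M\<^esub> x = \<zero>\<^bsub>M\<^esub>" using cls[OF x] triv by simp
    qed
  next
    assume tors: ?tors
    have "loc_rel R M p `` {v} = loc_zero R M p" if "v \<in> ?A" for v
    proof -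
      obtain x t where v: "v = (x, t)" by (cases v)
      then have "x \<in> carrier M" using that by simp
      then show ?thesis using tors cls[OF that[unfolded v]] unfolding v by simp
    qed
    then have "(\<lambda>v. loc_rel R M p `` {v}) ` ?A = (\<lambda>v. loc_zero R M p) ` ?A"
      by (intro image_cong) auto
    also have "\<dots> = {loc_zero R M p}" using z by (intro image_constant)
    finally show "localization R M p = {loc_zero R M p}" unfolding loc .
  qed
  also have "?tors \<longleftrightarrow> \<not> (\<exists>x\<in>carrier M. annihilator R M x \<subseteq> p)"
    unfolding annihilator_def by blast
  finally show ?thesis using p unfolding Supp_def by blast
qed

lemma Supp_upward_closed:
  assumes "p \<in> Supp R M" "q \<in> Spec R" "p \<subseteq> q"
  shows "q \<in> Supp R M"
proof -
  have "p \<in> Spec R" using assms(1) by (simp add: Supp_def)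
  then obtain x where "x \<in> carrier M" "annihilator R M x \<subseteq> p" using Supp_iff assms(1) by blast
  then have "\<exists>x\<in>carrier M. annihilator R M x \<subseteq> q" using assms(3) by blast
  then show ?thesis by (simp only: Supp_iff[OF assms(2)])
qed

lemma Ass_subset_Supp: "Ass R M \<subseteq> Supp R M"
proof
  fix p assume "p \<in> Ass R M"
  then have p: "p \<in> Spec R" and "\<exists>x\<in>carrier M. p = annihilator R M x" by (auto simp: Ass_def)
  then have "\<exists>x\<in>carrier M. annihilator R M x \<subseteq> p" by blast
  then show "p \<in> Supp R M" by (simp only: Supp_iff[OF p])
qed

text \<open>An ideal maximal among the annihilators of the nonzero multiples of \<open>x\<close> is prime. The
  version with a multiplicative set \<open>S\<close> is this fact for the image of \<open>x\<close> in the localization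
  at \<open>S\<close>: elements of \<open>S\<close> may be cancelled, because multiplying an element by some \<open>s \<in> S\<close> can
  only enlarge its annihilator to another one that avoids \<open>S\<close>,
  and maximality excludes a proper enlargement. The cases used are \<open>S = {1}\<close> and
  the complement of a prime ideal.\<close>

lemma exists_prime_annihilator_avoiding:
  assumes noeth: "noetherian_ring R"
    and S: "S \<subseteq> carrier R" "\<one>\<^bsub>R\<^esub> \<in> S" "\<And>s t. s \<in> S \<Longrightarrow> t \<in> S \<Longrightarrow> s \<otimes>\<^bsub>R\<^esub> t \<in> S"
    and x: "x \<in> carrier M" "annihilator R M x \<inter> S = {}"
  shows "\<exists>a\<in>carrier R. annihilator R M (a \<odot>\<^bsub>M\<^esub> x) \<in> Ass R M \<and>
    annihilator R M (a \<odot>\<^bsub>M\<^esub> x) \<inter> S = {}"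
proof -
  let ?ann = "annihilator R M"
  define \<A> where "\<A> = {?ann (a \<odot>\<^bsub>M\<^esub> x) | a. a \<in> carrier R \<and> ?ann (a \<odot>\<^bsub>M\<^esub> x) \<inter> S = {}}"
  have ne: "?ann x \<in> \<A>" unfolding \<A>_def using x by (intro CollectI exI[of _ "\<one>\<^bsub>R\<^esub>"]) simp
  have ideals: "\<A> \<subseteq> {I. ideal I R}" unfolding \<A>_def using x annihilator_ideal by auto
  have "\<exists>P\<in>\<A>. \<forall>I\<in>\<A>. P \<subseteq> I \<longrightarrow> I = P"
  proof (rule subset_Zorn)
    fix \<K> assume \<K>: "subset.chain \<A> \<K>"
    show "\<exists>U\<in>\<A>. \<forall>I\<in>\<K>. I \<subseteq> U"
    proof (cases "\<K> = {}")
      case True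
      then show ?thesis using ne by blast
    next
      case False
      have "subset.chain {I. ideal I R} \<K>" using \<K> ideals by (auto simp: subset_chain_def)
      then have "\<Union>\<K> \<in> \<K>" using noetherian_ring.ideal_chain_is_trivial[OF noeth False] by blast
      then show ?thesis using \<K> by (auto simp: subset_chain_def)
    qed
  qed
  then obtain P where P: "P \<in> \<A>" and "\<forall>I\<in>\<A>. P \<subseteq> I \<longrightarrow> I = P" by (elim bexE)
  moreover obtain a where a: "a \<in> carrier R" "?ann (a \<odot>\<^bsub>M\<^esub> x) \<inter> S = {}" and "P = ?ann (a \<odot>\<^bsub>M\<^esub> x)"
    using P unfolding \<A>_def by (elim CollectE exE conjE) simp
  ultimately have max: "\<And>I. I \<in> \<A> \<Longrightarrow> ?ann (a \<odot>\<^bsub>M\<^esub> x) \<subseteq> I \<Longrightarrow> I = ?ann (a \<odot>\<^bsub>M\<^esub> x)" by simp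
  let ?y = "a \<odot>\<^bsub>M\<^esub> x"
  have y: "?y \<in> carrier M" using a x by simp
  have larger: "?ann ?y \<subseteq> ?ann (c \<odot>\<^bsub>M\<^esub> ?y)" if "c \<in> carrier R" for c
  proof
    fix b assume b: "b \<in> ?ann ?y"
    have "b \<odot>\<^bsub>M\<^esub> (c \<odot>\<^bsub>M\<^esub> ?y) = c \<odot>\<^bsub>M\<^esub> (b \<odot>\<^bsub>M\<^esub> ?y)"
      using b that y smult_left_commute[of b c "?y"] by (simp add: annihilator_def)
    then show "b \<in> ?ann (c \<odot>\<^bsub>M\<^esub> ?y)" using b that unfolding annihilator_def by simp
  qed
  have stable: "?ann (c \<odot>\<^bsub>M\<^esub> ?y) = ?ann ?y"
    if c: "c \<in> carrier R" and "?ann (c \<odot>\<^bsub>M\<^esub> ?y) \<inter> S = {}" for c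
  proof (rule max[OF _ larger[OF c]])
    show "?ann (c \<odot>\<^bsub>M\<^esub> ?y) \<in> \<A>"
      unfolding \<A>_def using that a x
      by (intro CollectI exI[of _ "c \<otimes>\<^bsub>R\<^esub> a"]) (simp add: smult_assoc1)
  qed
  have stable_S: "?ann (s \<odot>\<^bsub>M\<^esub> ?y) = ?ann ?y" if s: "s \<in> S" for s
  proof (rule stable)
    show sc: "s \<in> carrier R" using s S by blast
    have False if t: "t \<in> S" "t \<in> ?ann (s \<odot>\<^bsub>M\<^esub> ?y)" for t
    proof -
      have "t \<otimes>\<^bsub>R\<^esub> s \<in> ?ann ?y" using t sc y by (auto simp: annihilator_def smult_assoc1)
      then show False using S(3)[OF t(1) s] a(2) by blast
    qed
    then show "?ann (s \<odot>\<^bsub>M\<^esub> ?y) \<inter> S = {}" by blast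
  qed
  have "primeideal (?ann ?y) R"
  proof (rule primeidealI)
    show "ideal (?ann ?y) R" by (rule annihilator_ideal[OF y])
    show "cring R" by (rule R.is_cring)
    show "carrier R \<noteq> ?ann ?y" using a(2) S by blast
  next
    fix b c assume bc: "b \<in> carrier R" "c \<in> carrier R" "b \<otimes>\<^bsub>R\<^esub> c \<in> ?ann ?y"
    then have b: "b \<in> ?ann (c \<odot>\<^bsub>M\<^esub> ?y)" using y by (simp add: annihilator_def smult_assoc1)
    show "b \<in> ?ann ?y \<or> c \<in> ?ann ?y"
    proof (cases "?ann (c \<odot>\<^bsub>M\<^esub> ?y) \<inter> S = {}")
      case True
      then show ?thesis using stable[OF bc(2)] b by simp
    next
      \<comment> \<open>Here some \<open>s \<in> S\<close> kills \<open>c y\<close>, so \<open>c\<close> kills \<open>s y\<close> and therefore \<open>y\<close>.\<close>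
      case False
      then obtain s where s: "s \<in> S" "s \<in> ?ann (c \<odot>\<^bsub>M\<^esub> ?y)" by blast
      then have sc: "s \<in> carrier R" using S by blast
      have "c \<odot>\<^bsub>M\<^esub> (s \<odot>\<^bsub>M\<^esub> ?y) = s \<odot>\<^bsub>M\<^esub> (c \<odot>\<^bsub>M\<^esub> ?y)"
        using sc bc(2) y smult_left_commute[of c s "?y"] by simp
      then have "c \<in> ?ann (s \<odot>\<^bsub>M\<^esub> ?y)" using s(2) bc(2) by (simp add: annihilator_def)
      then show ?thesis using stable_S[OF s(1)] by simp
    qed
  qed
  then have "?ann ?y \<in> Ass R M" using y by (auto simp: Ass_def Spec_def)
  then show ?thesis using a by (intro bexI[of _ a] conjI)
qed

lemma exists_associated_prime_multiple:
  assumes "noetherian_ring R" and x: "x \<in> carrier M" "x \<noteq> \<zero>\<^bsub>M\<^esub>"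
  shows "\<exists>a\<in>carrier R. annihilator R M (a \<odot>\<^bsub>M\<^esub> x) \<in> Ass R M"
proof -
  have "annihilator R M x \<inter> {\<one>\<^bsub>R\<^esub>} = {}" using x by (simp add: annihilator_def)
  then show ?thesis
    using exists_prime_annihilator_avoiding[OF assms(1), of "{\<one>\<^bsub>R\<^esub>}" x] x by auto
qed

text \<open>If the annihilator of \<open>x\<close> lies in \<open>p\<close>, some multiple of \<open>x\<close> has a prime annihilator that still
  lies in \<open>p\<close>.\<close>

lemma Supp_above_Ass:
  assumes "noetherian_ring R" and p: "p \<in> Supp R M"
  shows "\<exists>q\<in>Ass R M. q \<subseteq> p"
proof -
  have pS: "p \<in> Spec R" using p by (simp add: Supp_def)
  obtain x where x: "x \<in> carrier M" "annihilator R M x \<subseteq> p" using p Supp_iff[OF pS] by blast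
  have "annihilator R M x \<inter> (carrier R - p) = {}" using x(2) by blast
  then obtain a where a: "annihilator R M (a \<odot>\<^bsub>M\<^esub> x) \<in> Ass R M"
    "annihilator R M (a \<odot>\<^bsub>M\<^esub> x) \<inter> (carrier R - p) = {}"
    using exists_prime_annihilator_avoiding[of "carrier R - p" x] assms(1) SpecD(2,3)[OF pS] x(1)
    by auto
  moreover have "annihilator R M (a \<odot>\<^bsub>M\<^esub> x) \<subseteq> carrier R" by (auto simp: annihilator_def)
  ultimately show ?thesis by (intro bexI[OF _ a(1)]) blast
qed

end

lemma mod_hom_zero:
  assumes "module R M" "module R N" "f \<in> mod_hom R M N"
  shows "f \<zero>\<^bsub>M\<^esub> = \<zero>\<^bsub>N\<^esub>"
proof -
  interpret M: module R M by fact
  interpret N: module R N by fact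
  have "f (a \<odot>\<^bsub>M\<^esub> x) = a \<odot>\<^bsub>N\<^esub> f x" if "a \<in> carrier R" "x \<in> carrier M" for a x
    using assms(3) that unfolding mod_hom_def by blast
  from this[of "\<zero>\<^bsub>R\<^esub>" "\<zero>\<^bsub>M\<^esub>"] have "f \<zero>\<^bsub>M\<^esub> = \<zero>\<^bsub>R\<^esub> \<odot>\<^bsub>N\<^esub> f \<zero>\<^bsub>M\<^esub>" by simp
  moreover have "f \<zero>\<^bsub>M\<^esub> \<in> carrier N" using assms(3) unfolding mod_hom_def hom_def by auto
  ultimately show ?thesis by simp
qed

lemma Ass_iso:
  assumes M: "module R M" and N: "module R N" and iso: "mod_iso R M N"
  shows "Ass R N = Ass R M"
proof -
  interpret M: module R M by fact
  obtain f where f: "f \<in> mod_hom R M N" "bij_betw f (carrier M) (carrier N)"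
    using iso unfolding mod_iso_def by blast
  have "annihilator R N (f x) = annihilator R M x" if x: "x \<in> carrier M" for x
  proof -
    have "a \<odot>\<^bsub>N\<^esub> f x = \<zero>\<^bsub>N\<^esub> \<longleftrightarrow> a \<odot>\<^bsub>M\<^esub> x = \<zero>\<^bsub>M\<^esub>" if a: "a \<in> carrier R" for a
    proof -
      have "a \<odot>\<^bsub>N\<^esub> f x = f (a \<odot>\<^bsub>M\<^esub> x)" using f a x unfolding mod_hom_def by simp
      then have "a \<odot>\<^bsub>N\<^esub> f x = \<zero>\<^bsub>N\<^esub> \<longleftrightarrow> f (a \<odot>\<^bsub>M\<^esub> x) = f \<zero>\<^bsub>M\<^esub>"
        using mod_hom_zero[OF M N f(1)] by simp
      also have "\<dots> \<longleftrightarrow> a \<odot>\<^bsub>M\<^esub> x = \<zero>\<^bsub>M\<^esub>"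
        using a x by (intro inj_on_eq_iff[OF bij_betw_imp_inj_on[OF f(2)]]) simp_all
      finally show ?thesis .
    qed
    then show ?thesis unfolding annihilator_def by (intro Collect_cong conj_cong refl)
  qed
  moreover have "carrier N = f ` carrier M" using bij_betw_imp_surj_on[OF f(2)] by simp
  ultimately show ?thesis unfolding Ass_def by auto
qed

section \<open>Vanishing of Hom in terms of supports and associated primes\<close>

text \<open>Multiplication by \<open>s\<close> maps \<open>M\<close> into \<open>R a + K\<close>. The quotient \<open>(R a + K) / K\<close> is cyclic,
  generated by the class of \<open>a\<close>, so this class may be sent to any element \<open>y\<close> that is killed by the
  ideal \<open>(K : a)\<close>. The composite sends \<open>x\<close> to \<open>r y\<close> when \<open>s x\<close> and \<open>r a\<close> agree modulo \<open>K\<close>.\<close>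

lemma exists_hom_from_cyclic_quotient:
  assumes M: "module R M" and N: "module R N" and K: "submodule K R M"
    and a: "a \<in> carrier M" and s: "s \<in> carrier R" and y: "y \<in> carrier N"
    and gen: "\<And>x. x \<in> carrier M \<Longrightarrow> \<exists>r\<in>carrier R. \<exists>k\<in>K. s \<odot>\<^bsub>M\<^esub> x = r \<odot>\<^bsub>M\<^esub> a \<oplus>\<^bsub>M\<^esub> k"
    and kill: "\<And>r. r \<in> carrier R \<Longrightarrow> r \<odot>\<^bsub>M\<^esub> a \<in> K \<Longrightarrow> r \<odot>\<^bsub>N\<^esub> y = \<zero>\<^bsub>N\<^esub>"
  shows "\<exists>f\<in>mod_hom R M N. f a = s \<odot>\<^bsub>N\<^esub> y"
proof -
  interpret M: module R M by fact
  interpret N: module R N by fact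
  note KE = M.submoduleE[OF K]
  define rep where "rep x r \<longleftrightarrow> r \<in> carrier R \<and> (\<exists>k\<in>K. s \<odot>\<^bsub>M\<^esub> x = r \<odot>\<^bsub>M\<^esub> a \<oplus>\<^bsub>M\<^esub> k)" for x r
  define f where "f x = (SOME r. rep x r) \<odot>\<^bsub>N\<^esub> y" for x
  have kc: "k \<in> carrier M" if "k \<in> K" for k using that KE(1) by blast
  have ex: "\<exists>r. rep x r" if "x \<in> carrier M" for x using gen[OF that] unfolding rep_def by blast
  have unique: "r \<odot>\<^bsub>N\<^esub> y = r' \<odot>\<^bsub>N\<^esub> y" if "rep x r" "rep x r'" for x r r'
  proof -
    obtain k k' where r: "r \<in> carrier R" "r' \<in> carrier R" and k: "k \<in> K" "k' \<in> K"
      and e: "r \<odot>\<^bsub>M\<^esub> a \<oplus>\<^bsub>M\<^esub> k = r' \<odot>\<^bsub>M\<^esub> a \<oplus>\<^bsub>M\<^esub> k'"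
      using \<open>rep x r\<close> \<open>rep x r'\<close> unfolding rep_def by auto
    have "(r \<ominus>\<^bsub>R\<^esub> r') \<odot>\<^bsub>M\<^esub> a = (r \<odot>\<^bsub>M\<^esub> a \<oplus>\<^bsub>M\<^esub> k) \<oplus>\<^bsub>M\<^esub> (\<ominus>\<^bsub>M\<^esub> (r' \<odot>\<^bsub>M\<^esub> a) \<oplus>\<^bsub>M\<^esub> \<ominus>\<^bsub>M\<^esub> k)"
      using r a kc[OF k(1)] by (simp add: a_minus_def M.smult_l_distr M.smult_l_minus M.M.a_ac M.M.r_neg M.M.r_neg1 M.M.r_neg2)
    also have "\<dots> = k' \<oplus>\<^bsub>M\<^esub> \<ominus>\<^bsub>M\<^esub> k"
      unfolding e using r a kc[OF k(1)] kc[OF k(2)] by (simp add: M.M.a_ac M.M.r_neg M.M.r_neg1 M.M.r_neg2)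
    finally have "(r \<ominus>\<^bsub>R\<^esub> r') \<odot>\<^bsub>M\<^esub> a \<in> K" using k KE(3,5) by simp
    then have "(r \<ominus>\<^bsub>R\<^esub> r') \<odot>\<^bsub>N\<^esub> y = \<zero>\<^bsub>N\<^esub>" using kill r by simp
    then have "r \<odot>\<^bsub>N\<^esub> y \<oplus>\<^bsub>N\<^esub> \<ominus>\<^bsub>N\<^esub> (r' \<odot>\<^bsub>N\<^esub> y) = \<zero>\<^bsub>N\<^esub>"
      using r y by (simp add: a_minus_def N.smult_l_distr N.smult_l_minus)
    then show ?thesis using r y by (metis N.M.minus_equality N.M.minus_minus N.smult_closed N.M.a_inv_closed)
  qed
  have f: "f x = r \<odot>\<^bsub>N\<^esub> y" if "x \<in> carrier M" "rep x r" for x r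
    unfolding f_def using someI[of "rep x" r] that unique by blast
  have fc: "f x \<in> carrier N" if x: "x \<in> carrier M" for x
  proof -
    obtain r where r: "rep x r" using ex[OF x] by (elim exE)
    then have "r \<in> carrier R" by (simp add: rep_def)
    then show ?thesis using f[OF x r] y by simp
  qed
  have add: "f (u \<oplus>\<^bsub>M\<^esub> v) = f u \<oplus>\<^bsub>N\<^esub> f v" if uv: "u \<in> carrier M" "v \<in> carrier M" for u v
  proof -
    obtain r k r' k' where *: "r \<in> carrier R" "k \<in> K" "s \<odot>\<^bsub>M\<^esub> u = r \<odot>\<^bsub>M\<^esub> a \<oplus>\<^bsub>M\<^esub> k"
      "r' \<in> carrier R" "k' \<in> K" "s \<odot>\<^bsub>M\<^esub> v = r' \<odot>\<^bsub>M\<^esub> a \<oplus>\<^bsub>M\<^esub> k'"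
      using gen[OF uv(1)] gen[OF uv(2)] by (elim bexE) simp
    have "s \<odot>\<^bsub>M\<^esub> (u \<oplus>\<^bsub>M\<^esub> v) = (r \<oplus>\<^bsub>R\<^esub> r') \<odot>\<^bsub>M\<^esub> a \<oplus>\<^bsub>M\<^esub> (k \<oplus>\<^bsub>M\<^esub> k')"
      using * uv s a kc by (simp add: M.smult_r_distr M.smult_l_distr M.M.a_ac)
    then have "rep (u \<oplus>\<^bsub>M\<^esub> v) (r \<oplus>\<^bsub>R\<^esub> r')" 
      using * KE(5) unfolding rep_def by (intro conjI bexI[of _ "k \<oplus>\<^bsub>M\<^esub> k'"]) simp_all
    moreover have "rep u r" "rep v r'" using * unfolding rep_def by blast+
    ultimately have "f (u \<oplus>\<^bsub>M\<^esub> v) = (r \<oplus>\<^bsub>R\<^esub> r') \<odot>\<^bsub>N\<^esub> y" "f u = r \<odot>\<^bsub>N\<^esub> y" "f v = r' \<odot>\<^bsub>N\<^esub> y"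
      using uv by (simp_all add: f)
    then show ?thesis using * y by (simp add: N.smult_l_distr)
  qed
  have smult: "f (c \<odot>\<^bsub>M\<^esub> u) = c \<odot>\<^bsub>N\<^esub> f u" if c: "c \<in> carrier R" and u: "u \<in> carrier M" for c u
  proof -
    obtain r k where *: "r \<in> carrier R" "k \<in> K" "s \<odot>\<^bsub>M\<^esub> u = r \<odot>\<^bsub>M\<^esub> a \<oplus>\<^bsub>M\<^esub> k"
      using gen[OF u] by blast
    have "s \<odot>\<^bsub>M\<^esub> (c \<odot>\<^bsub>M\<^esub> u) = c \<odot>\<^bsub>M\<^esub> (s \<odot>\<^bsub>M\<^esub> u)"
      using s c u M.smult_left_commute[of s c u] by simp
    also have "\<dots> = (c \<otimes>\<^bsub>R\<^esub> r) \<odot>\<^bsub>M\<^esub> a \<oplus>\<^bsub>M\<^esub> c \<odot>\<^bsub>M\<^esub> k"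
      using * c a kc by (simp add: M.smult_r_distr M.smult_assoc1)
    finally have "rep (c \<odot>\<^bsub>M\<^esub> u) (c \<otimes>\<^bsub>R\<^esub> r)" 
      using * c KE(4) unfolding rep_def by (intro conjI bexI[of _ "c \<odot>\<^bsub>M\<^esub> k"]) simp_all
    moreover have "rep u r" using * unfolding rep_def by blast
    ultimately have "f (c \<odot>\<^bsub>M\<^esub> u) = (c \<otimes>\<^bsub>R\<^esub> r) \<odot>\<^bsub>N\<^esub> y" "f u = r \<odot>\<^bsub>N\<^esub> y"
      using c u by (simp_all add: f)
    then show ?thesis using c * y by (simp add: N.smult_assoc1)
  qed
  have "f \<in> mod_hom R M N"
    unfolding mod_hom_def hom_def using fc add smult by auto
  moreover have "rep a s"
    unfolding rep_def using s a M.submodule_zero[OF K] by (intro conjI bexI[of _ "\<zero>\<^bsub>M\<^esub>"]) simp_all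
  then have "f a = s \<odot>\<^bsub>N\<^esub> y" by (rule f[OF a])
  ultimately show ?thesis by blast
qed

text \<open>When the generators are added one at a time, the localization of their span at \<open>p\<close> is not
  all of \<open>M\<^sub>p\<close> at the beginning, since \<open>p\<close> lies in the support, and is all of it at the end. Let \<open>a\<close>
  be the generator added at the critical stage and \<open>K\<close> the span before it. Then \<open>M\<^sub>p / K\<^sub>p\<close> is
  nonzero and generated by \<open>a\<close>. This does the work of Nakayama's lemma.\<close>

lemma exists_local_cyclic_quotient:
  fixes M :: "('a, 'm) module"
  assumes M: "module R M" and fg: "finite A" "A \<subseteq> carrier M" "span_of R M A = carrier M"
    and p: "p \<in> Supp R M"
  obtains K a s where "submodule K R M" "a \<in> carrier M" "s \<in> carrier R - p"
    "\<And>x. x \<in> carrier M \<Longrightarrow> \<exists>r\<in>carrier R. \<exists>k\<in>K. s \<odot>\<^bsub>M\<^esub> x = r \<odot>\<^bsub>M\<^esub> a \<oplus>\<^bsub>M\<^esub> k"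
    "\<And>r. r \<in> carrier R \<Longrightarrow> r \<odot>\<^bsub>M\<^esub> a \<in> K \<Longrightarrow> r \<in> p"
proof -
  interpret module R M by (rule M)
  have pS: "p \<in> Spec R" using p by (simp add: Supp_def)
  \<comment> \<open>\<open>full B\<close>: the span of \<open>B\<close> becomes everything after localization at \<open>p\<close>. One denominator
    for all \<open>x\<close> suffices because \<open>M\<close> is finitely generated.\<close>
  define full where "full B \<longleftrightarrow> (\<exists>s\<in>carrier R - p. \<forall>x\<in>carrier M. s \<odot>\<^bsub>M\<^esub> x \<in> span_of R M B)" for B
  have "full A" unfolding full_def using fg(3) SpecD(2)[OF pS] by (intro bexI[of _ "\<one>\<^bsub>R\<^esub>"]) auto
  have "\<not> full {}"
  proof
    assume "full {}"
    moreover have "span_of R M {} = {\<zero>\<^bsub>M\<^esub>}"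
      using submodule_zero_set by (intro hull_unique) (auto simp: submodule_zero)
    ultimately obtain s where s: "s \<in> carrier R - p" "\<forall>x\<in>carrier M. s \<odot>\<^bsub>M\<^esub> x = \<zero>\<^bsub>M\<^esub>"
      unfolding full_def by auto
    then show False using p Supp_iff[OF M pS] unfolding annihilator_def by blast
  qed
  have "\<exists>B a. insert a B \<subseteq> A \<and> \<not> full B \<and> full (insert a B)"
    using fg(1) \<open>full A\<close> \<open>\<not> full {}\<close>
  proof (induction A rule: finite_induct)
    case (insert a B)
    then show ?case by (cases "full B") blast+
  qed simp
  then obtain B a where B: "B \<subseteq> carrier M" and a: "a \<in> carrier M"
    and nB: "\<not> full B" and aB: "full (insert a B)" using fg(2) by blast
  let ?K = "span_of R M B"
  note K = span_of_submodule[OF B]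
  obtain s where s: "s \<in> carrier R - p"
    and sM: "\<And>x. x \<in> carrier M \<Longrightarrow> s \<odot>\<^bsub>M\<^esub> x \<in> span_of R M (insert a B)"
    using aB unfolding full_def by blast
  show thesis
  proof (rule that[OF K a s])
    show "\<exists>r\<in>carrier R. \<exists>k\<in>?K. s \<odot>\<^bsub>M\<^esub> x = r \<odot>\<^bsub>M\<^esub> a \<oplus>\<^bsub>M\<^esub> k" if "x \<in> carrier M" for x
      by (rule span_of_insert[OF B a sM[OF that]])
    show "r \<in> p" if r: "r \<in> carrier R" "r \<odot>\<^bsub>M\<^esub> a \<in> ?K" for r
    proof (rule ccontr)
      assume "r \<notin> p"
      then have rs: "r \<otimes>\<^bsub>R\<^esub> s \<in> carrier R - p" using SpecD(3)[OF pS] r s by blast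
      have "r \<odot>\<^bsub>M\<^esub> x \<in> ?K" if "x \<in> insert a B" for x
        using that r submoduleE(4)[OF K r(1)] hull_inc[of x B] by auto
      then have "r \<odot>\<^bsub>M\<^esub> (s \<odot>\<^bsub>M\<^esub> x) \<in> ?K" if "x \<in> carrier M" for x
        using smult_span_of_subset[OF K _ r(1) _ sM[OF that]] a B by blast
      then have "full B" unfolding full_def using rs r s by (intro bexI[OF _ rs]) (auto simp: smult_assoc1)
      then show False using nB by blast
    qed
  qed
qed

text \<open>A nonzero map \<open>M \<rightarrow> N\<close> has an associated prime in its image, and a preimage of the
  corresponding element shows that this prime is in \<open>Supp M\<close>. Conversely, for a prime \<open>p\<close> in
  both sets a nonzero cyclic quotient of \<open>M\<close> at \<open>p\<close> maps to a copy of \<open>R/p\<close> in \<open>N\<close>, nontrivially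
  since the denominator \<open>s\<close> acts injectively on \<open>R/p\<close>.\<close>

lemma Hom_zero_iff_Supp_Ass_disjoint:
  assumes noeth: "noetherian_ring R" and M: "M \<in> mod_cat R" and N: "module R N"
  shows "Hom_zero R M N \<longleftrightarrow> Supp R M \<inter> Ass R N = {}"
proof
  have fM: "fin_gen_module R M" using M by (simp add: mod_cat_def)
  interpret M: module R M using fM by (simp add: fin_gen_module_def)
  interpret N: module R N by fact
  {
    assume hz: "Hom_zero R M N"
    have False if p: "p \<in> Supp R M" "p \<in> Ass R N" for p
    proof -
      obtain y where y: "y \<in> carrier N" "p = annihilator R N y" using p(2) unfolding Ass_def by blast
      obtain A where A: "finite A" "A \<subseteq> carrier M" "span_of R M A = carrier M"
        using fM unfolding fin_gen_module_def by blast
      obtain K a s where K: "submodule K R M" "a \<in> carrier M" "s \<in> carrier R - p"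
        "\<And>x. x \<in> carrier M \<Longrightarrow> \<exists>r\<in>carrier R. \<exists>k\<in>K. s \<odot>\<^bsub>M\<^esub> x = r \<odot>\<^bsub>M\<^esub> a \<oplus>\<^bsub>M\<^esub> k"
        "\<And>r. r \<in> carrier R \<Longrightarrow> r \<odot>\<^bsub>M\<^esub> a \<in> K \<Longrightarrow> r \<in> p"
        using exists_local_cyclic_quotient[OF M.module_axioms A p(1)] by blast
      have "s \<in> carrier R" using K(3) by blast
      then obtain f where "f \<in> mod_hom R M N" "f a = s \<odot>\<^bsub>N\<^esub> y"
        using exists_hom_from_cyclic_quotient[OF M.module_axioms N K(1,2) _ y(1) K(4)] K(5)
        unfolding y(2) annihilator_def by blast
      then have "s \<odot>\<^bsub>N\<^esub> y = \<zero>\<^bsub>N\<^esub>" using hz K(2) unfolding Hom_zero_def by auto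
      then show False using K(3) unfolding y(2) annihilator_def by blast
    qed
    then show "Supp R M \<inter> Ass R N = {}" by blast
  next
    assume disj: "Supp R M \<inter> Ass R N = {}"
    show "Hom_zero R M N"
      unfolding Hom_zero_def
    proof (intro ballI, rule ccontr)
      fix f x assume f: "f \<in> mod_hom R M N" and x: "x \<in> carrier M" and nz: "f x \<noteq> \<zero>\<^bsub>N\<^esub>"
      have fc: "f u \<in> carrier N" if "u \<in> carrier M" for u
        using f that unfolding mod_hom_def hom_def by auto
      have fs: "f (c \<odot>\<^bsub>M\<^esub> u) = c \<odot>\<^bsub>N\<^esub> f u" if "c \<in> carrier R" "u \<in> carrier M" for c u
        using f that unfolding mod_hom_def by blast
      obtain a where a: "a \<in> carrier R" "annihilator R N (a \<odot>\<^bsub>N\<^esub> f x) \<in> Ass R N"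
        using exists_associated_prime_multiple[OF N noeth fc[OF x] nz] by blast
      let ?p = "annihilator R N (a \<odot>\<^bsub>N\<^esub> f x)"
      have ax: "a \<odot>\<^bsub>M\<^esub> x \<in> carrier M" using a x by simp
      have "annihilator R M (a \<odot>\<^bsub>M\<^esub> x) \<subseteq> ?p"
      proof
        fix c assume c: "c \<in> annihilator R M (a \<odot>\<^bsub>M\<^esub> x)"
        then have "c \<in> carrier R" "f (c \<odot>\<^bsub>M\<^esub> (a \<odot>\<^bsub>M\<^esub> x)) = \<zero>\<^bsub>N\<^esub>"
          using mod_hom_zero[OF M.module_axioms N f] by (simp_all add: annihilator_def)
        then show "c \<in> ?p" using fs[OF _ ax] fs[OF a(1) x] by (simp add: annihilator_def)
      qed
      moreover have "?p \<in> Spec R" using a(2) by (simp add: Ass_def)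
      ultimately have "?p \<in> Supp R M" using Supp_iff[OF M.module_axioms] ax by blast
      then show False using a(2) disj by blast
    qed
  }
qed

section \<open>Weak torsion pairs\<close>

text \<open>The closure of \<open>{p}\<close> in \<open>\<Delta>\<close> consists of the primes of \<open>\<Delta>\<close> that contain \<open>p\<close>: the primes not
  containing \<open>p\<close> form the open set given by the ideal \<open>p\<close>, and \<open>p\<close> is not in it.\<close>

lemma spcl_iff:
  assumes "cring R" and \<Delta>: "\<Delta> \<subseteq> Spec R"
  shows "Z \<in> spcl R \<Delta> \<longleftrightarrow> Z \<subseteq> \<Delta> \<and> (\<forall>p\<in>Z. \<forall>q\<in>\<Delta>. p \<subseteq> q \<longrightarrow> q \<in> Z)"
proof -
  interpret cring R by fact
  have ideal: "ideal p R" if "p \<in> Spec R" for p using that by (simp add: Spec_def primeideal_def)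
  have "openin (zariski R) (Spec R)"
  proof -
    have "ideal (carrier R) R" by (rule oneideal)
    moreover have "Spec R = {p \<in> Spec R. \<not> carrier R \<subseteq> p}" using SpecD(2) by blast
    ultimately show ?thesis using openin_zariski[OF assms(1)] by blast
  qed
  moreover have "topspace (zariski R) \<subseteq> Spec R"
    unfolding topspace_def using openin_zariski[OF assms(1)] by blast
  ultimately have top: "topspace (zariski R) = Spec R" using openin_subset by blast
  have cl: "subtopology (zariski R) \<Delta> closure_of {p} = {q \<in> \<Delta>. p \<subseteq> q}" if p: "p \<in> \<Delta>" for p
  proof -
    have "q \<in> zariski R closure_of {p} \<longleftrightarrow> p \<subseteq> q" if q: "q \<in> \<Delta>" for q
    proof -
      have "q \<in> zariski R closure_of {p} \<longleftrightarrow> (\<forall>I. ideal I R \<longrightarrow> I \<subseteq> p \<longrightarrow> I \<subseteq> q)"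
      proof -
        have "q \<in> Spec R" "p \<in> Spec R" using p q \<Delta> by blast+
        then show ?thesis unfolding in_closure_of top openin_zariski[OF assms(1)] by blast
      qed
      then show ?thesis using ideal[of p] p \<Delta> by blast
    qed
    then show ?thesis using closure_of_subtopology_open[of "zariski R" \<Delta> "{p}"] p by blast
  qed
  show ?thesis unfolding spcl_def using cl by blast
qed

lemma mod_cat_module: "M \<in> mod_cat R \<Longrightarrow> module R M"
  by (simp add: mod_cat_def fin_gen_module_def)

lemma right_perp_eq:
  assumes "noetherian_ring R" "\<U> \<subseteq> mod_cat R" "\<T> \<subseteq> mod_cat R"
  shows "right_perp R \<U> \<T> = {M \<in> \<U>. Supp_cat R \<T> \<inter> Ass R M = {}}"
proof -
  have "Hom_zero R D M \<longleftrightarrow> Supp R D \<inter> Ass R M = {}" if "D \<in> \<T>" "M \<in> \<U>" for D M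
    using Hom_zero_iff_Supp_Ass_disjoint[OF assms(1)] mod_cat_module that assms by blast
  then show ?thesis unfolding right_perp_def Supp_cat_def by blast
qed

lemma left_perp_eq:
  assumes "noetherian_ring R" "\<U> \<subseteq> mod_cat R" "\<F> \<subseteq> mod_cat R"
  shows "left_perp R \<U> \<F> = {M \<in> \<U>. Supp R M \<inter> Ass_cat R \<F> = {}}"
proof -
  have "Hom_zero R M D \<longleftrightarrow> Supp R M \<inter> Ass R D = {}" if "D \<in> \<F>" "M \<in> \<U>" for D M
    using Hom_zero_iff_Supp_Ass_disjoint[OF assms(1)] mod_cat_module that assms by blast
  then show ?thesis unfolding left_perp_def Ass_cat_def by blast
qed

lemma Supp_subset_of_spcl:
  assumes R: "cring R" "noetherian_ring R" and \<Delta>: "\<Delta> \<subseteq> Spec R" and Z: "Z \<in> spcl R \<Delta>"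
    and M: "M \<in> Ass_inv R Z"
  shows "\<Delta> \<inter> Supp R M \<subseteq> Z"
proof
  fix p assume p: "p \<in> \<Delta> \<inter> Supp R M"
  have "module R M" using M by (simp add: Ass_inv_def mod_cat_module)
  then obtain q where "q \<in> Ass R M" "q \<subseteq> p" using Supp_above_Ass[OF _ R(2)] p by blast
  then show "p \<in> Z" using M Z p spcl_iff[OF R(1) \<Delta>] unfolding Ass_inv_def by blast
qed

lemma Supp_cat_of_spcl:
  assumes R: "cring R" "noetherian_ring R" and \<Delta>: "\<Delta> \<subseteq> Spec R" and Z: "Z \<in> spcl R \<Delta>"
    and \<T>: "\<T> \<subseteq> Ass_inv R Z" "\<forall>p\<in>Z. \<exists>M\<in>\<T>. Ass R M = {p}"
  shows "\<Delta> \<inter> Supp_cat R \<T> = Z"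
proof
  show "\<Delta> \<inter> Supp_cat R \<T> \<subseteq> Z"
    using Supp_subset_of_spcl[OF R \<Delta> Z] \<T>(1) unfolding Supp_cat_def by blast
  show "Z \<subseteq> \<Delta> \<inter> Supp_cat R \<T>"
  proof
    fix p assume p: "p \<in> Z"
    then obtain M where M: "M \<in> \<T>" "Ass R M = {p}" using \<T>(2) by blast
    then have "module R M" using \<T>(1) by (auto simp: Ass_inv_def mod_cat_module)
    then have "p \<in> Supp R M" using Ass_subset_Supp M(2) by blast
    then show "p \<in> \<Delta> \<inter> Supp_cat R \<T>" using p M Z unfolding spcl_def Supp_cat_def by blast
  qed
qed

lemma right_perp_eq_Ass_inv:
  assumes "noetherian_ring R" and \<U>: "\<U> \<subseteq> Ass_inv R \<Delta>" and \<T>: "\<T> \<subseteq> mod_cat R"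
  shows "right_perp R \<U> \<T> = Ass_inv R (\<Delta> - \<Delta> \<inter> Supp_cat R \<T>) \<inter> \<U>"
proof -
  have M: "\<U> \<subseteq> mod_cat R" using \<U> by (auto simp: Ass_inv_def)
  have "Supp_cat R \<T> \<inter> Ass R M = {} \<longleftrightarrow> M \<in> Ass_inv R (\<Delta> - \<Delta> \<inter> Supp_cat R \<T>)" if "M \<in> \<U>" for M
  proof -
    have "Ass R M \<subseteq> \<Delta>" "M \<in> mod_cat R" using \<U> that by (auto simp: Ass_inv_def)
    then show ?thesis unfolding Ass_inv_def by blast
  qed
  then show ?thesis unfolding right_perp_eq[OF assms(1) M \<T>] by blast
qed

text \<open>The modules with a single associated prime \<open>p \<in> \<Delta> - Z\<close> force the associated primes of the
  left perpendicular into \<open>Z\<close>. Conversely, \<open>Ass M \<subseteq> Z\<close> keeps \<open>Supp M\<close> away from \<open>\<Delta> - Z\<close>, as \<open>Z\<close> is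
  specialization-closed.\<close>

lemma left_perp_Ass_inv:
  assumes R: "cring R" "noetherian_ring R" and \<Delta>: "\<Delta> \<subseteq> Spec R" and Z: "Z \<in> spcl R \<Delta>"
    and \<U>: "\<U> \<subseteq> Ass_inv R \<Delta>" "\<forall>p\<in>\<Delta>. \<exists>M\<in>\<U>. Ass R M = {p}"
  shows "left_perp R \<U> (Ass_inv R (\<Delta> - Z) \<inter> \<U>) = Ass_inv R Z \<inter> \<U>"
proof -
  have sub: "Ass_inv R W \<subseteq> mod_cat R" for W by (auto simp: Ass_inv_def)
  have "Ass_cat R (Ass_inv R (\<Delta> - Z) \<inter> \<U>) = \<Delta> - Z"
  proof
    show "\<Delta> - Z \<subseteq> Ass_cat R (Ass_inv R (\<Delta> - Z) \<inter> \<U>)"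
    proof
      fix p assume p: "p \<in> \<Delta> - Z"
      then obtain M where M: "M \<in> \<U>" "Ass R M = {p}" using \<U>(2) by blast
      then have "M \<in> Ass_inv R (\<Delta> - Z) \<inter> \<U>" using p \<U>(1) by (auto simp: Ass_inv_def)
      then show "p \<in> Ass_cat R (Ass_inv R (\<Delta> - Z) \<inter> \<U>)" using M(2) by (auto simp: Ass_cat_def)
    qed
  qed (auto simp: Ass_cat_def Ass_inv_def)
  then have "left_perp R \<U> (Ass_inv R (\<Delta> - Z) \<inter> \<U>) = {M \<in> \<U>. Supp R M \<inter> (\<Delta> - Z) = {}}"
    using left_perp_eq[OF R(2) subset_trans[OF \<U>(1) sub] le_infI1[OF sub], of "\<Delta> - Z"] by simp
  also have "\<dots> = Ass_inv R Z \<inter> \<U>"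
  proof (intro equalityI subsetI)
    fix M assume M: "M \<in> {M \<in> \<U>. Supp R M \<inter> (\<Delta> - Z) = {}}"
    then have "M \<in> mod_cat R" "Ass R M \<subseteq> \<Delta>" using \<U>(1) unfolding Ass_inv_def by blast+
    then show "M \<in> Ass_inv R Z \<inter> \<U>"
      using M Ass_subset_Supp[OF mod_cat_module, of M R] by (auto simp: Ass_inv_def)
  next
    fix M assume "M \<in> Ass_inv R Z \<inter> \<U>"
    then show "M \<in> {M \<in> \<U>. Supp R M \<inter> (\<Delta> - Z) = {}}"
      using Supp_subset_of_spcl[OF R \<Delta> Z, of M] by blast
  qed
  finally show ?thesis .
qed

text \<open>Only the support of \<open>\<T>\<close> inside \<open>\<Delta>\<close> matters, and it is \<open>Z\<close>. The sets \<open>\<T>\<close> and \<open>\<U>\<close> vary separately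
  because \<open>Psi\<close> takes the perpendicular of a subcategory of \<open>\<C>\<close> in a bigger category.\<close>

lemma right_perp_spcl:
  assumes R: "cring R" "noetherian_ring R" and \<Delta>: "\<Delta> \<subseteq> Spec R" and Z: "Z \<in> spcl R \<Delta>"
    and \<U>: "\<U> \<subseteq> Ass_inv R \<Delta>"
    and \<T>: "\<T> \<subseteq> Ass_inv R Z" "\<forall>p\<in>Z. \<exists>M\<in>\<T>. Ass R M = {p}"
  shows "right_perp R \<U> \<T> = Ass_inv R (\<Delta> - Z) \<inter> \<U>"
proof -
  have "\<T> \<subseteq> mod_cat R" using \<T>(1) by (auto simp: Ass_inv_def)
  then show ?thesis
    using right_perp_eq_Ass_inv[OF R(2) \<U>] Supp_cat_of_spcl[OF R \<Delta> Z \<T>] by simp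
qed

lemma subcategory_Ass_inv_Int:
  fixes R :: "('a, 'r) ring_scheme" and \<C> :: "('a, 'm) module set"
  assumes "subcategory R \<C>"
  shows "subcategory R (Ass_inv R W \<inter> \<C>)"
  unfolding subcategory_def
proof (intro conjI ballI impI)
  show "Ass_inv R W \<inter> \<C> \<subseteq> mod_cat R" by (auto simp: Ass_inv_def)
  fix M N :: "('a, 'm) module"
  assume M: "M \<in> Ass_inv R W \<inter> \<C>" and N: "N \<in> mod_cat R" and iso: "mod_iso R M N"
  have "N \<in> \<C>" using assms M N iso unfolding subcategory_def by blast
  moreover have "module R M" using M by (simp add: Ass_inv_def mod_cat_module)
  then have "Ass R N = Ass R M" by (rule Ass_iso[OF _ mod_cat_module[OF N] iso])
  ultimately show "N \<in> Ass_inv R W \<inter> \<C>" using M N by (simp add: Ass_inv_def)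
qed

lemma Ass_inv_singletons:
  assumes "\<forall>p\<in>\<Delta>. \<exists>M\<in>\<U>. Ass R M = {p}" and "\<U> \<subseteq> mod_cat R" and "Z \<subseteq> \<Delta>"
  shows "\<forall>p\<in>Z. \<exists>M\<in>Ass_inv R Z \<inter> \<U>. Ass R M = {p}"
proof
  fix p assume p: "p \<in> Z"
  then obtain M where "M \<in> \<U>" "Ass R M = {p}" using assms(1,3) by blast
  then show "\<exists>M\<in>Ass_inv R Z \<inter> \<U>. Ass R M = {p}"
    using p assms(2) by (intro bexI[of _ M]) (auto simp: Ass_inv_def)
qed

theorem theorem4p18:
  fixes R :: "('a, 'r) ring_scheme" and \<C> :: "('a, 'm) module set" and \<Delta> :: "'a set set"
  assumes "cring R" and "noetherian_ring R"
    and "subcategory R \<C>"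
    and "\<forall>p\<in>Ass_cat R \<C>. \<exists>M\<in>\<C>. Ass R M = {p}"
    and "\<Delta> = Ass_cat R \<C>"
  shows "(\<forall>Z\<in>spcl R \<Delta>. Phi R \<C> Z = (Ass_inv R Z \<inter> \<C>, Ass_inv R (\<Delta> - Z) \<inter> \<C>))
    \<and> bij_betw (Phi R \<C>) (spcl R \<Delta>) (wtp R \<C>)
    \<and> bij_betw (Psi R \<Delta>) (wtp R \<C>) (spcl R \<Delta>)
    \<and> (\<forall>Z\<in>spcl R \<Delta>. Psi R \<Delta> (Phi R \<C> Z) = Z)
    \<and> (\<forall>P\<in>wtp R \<C>. Phi R \<C> (Psi R \<Delta> P) = P)
    \<and> (\<exists>f. bij_betw f (spcl R (Ass_cat R \<C>)) (wtp R \<C>))"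
proof -
  note R = assms(1,2)
  have \<Delta>: "\<Delta> \<subseteq> Spec R" using assms(5) unfolding Ass_cat_def Ass_def by blast
  have CM: "\<C> \<subseteq> mod_cat R" using assms(3) unfolding subcategory_def by blast
  have C: "\<C> \<subseteq> Ass_inv R \<Delta>" using CM assms(5) unfolding Ass_inv_def Ass_cat_def by blast
  have single: "\<forall>p\<in>\<Delta>. \<exists>M\<in>\<C>. Ass R M = {p}" using assms(4,5) by simp
  have singleZ: "\<forall>p\<in>Z. \<exists>M\<in>Ass_inv R Z \<inter> \<C>. Ass R M = {p}" if "Z \<in> spcl R \<Delta>" for Z
    using Ass_inv_singletons[OF single CM] that unfolding spcl_def by blast
  have right: "right_perp R \<C> (Ass_inv R Z \<inter> \<C>) = Ass_inv R (\<Delta> - Z) \<inter> \<C>"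
    and left: "left_perp R \<C> (Ass_inv R (\<Delta> - Z) \<inter> \<C>) = Ass_inv R Z \<inter> \<C>"
    if Z: "Z \<in> spcl R \<Delta>" for Z
    using right_perp_spcl[OF R \<Delta> Z C _ singleZ[OF Z]] left_perp_Ass_inv[OF R \<Delta> Z C single] by auto
  have Phi: "Phi R \<C> Z = (Ass_inv R Z \<inter> \<C>, Ass_inv R (\<Delta> - Z) \<inter> \<C>)" if "Z \<in> spcl R \<Delta>" for Z
    unfolding Phi_def Let_def using right[OF that] left[OF that] by simp
  have Phi_wtp: "Phi R \<C> Z \<in> wtp R \<C>" if Z: "Z \<in> spcl R \<Delta>" for Z
    unfolding Phi[OF Z] wtp_def using right[OF Z] left[OF Z] subcategory_Ass_inv_Int[OF assms(3)] by auto
  have Psi_Phi: "Psi R \<Delta> (Phi R \<C> Z) = Z" if Z: "Z \<in> spcl R \<Delta>" for Z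
  proof -
    \<comment> \<open>\<open>\<C> \<subseteq> ?Y\<close> provides the modules with a single associated prime in \<open>?Y\<close> too.\<close>
    let ?Y = "Ass_inv R \<Delta> :: ('a, 'm) module set"
    have singleY: "\<forall>p\<in>\<Delta>. \<exists>M\<in>?Y. Ass R M = {p}" using single C by blast
    have Y: "?Y \<subseteq> mod_cat R" by (auto simp: Ass_inv_def)
    have "right_perp R ?Y (Ass_inv R Z \<inter> \<C>) = Ass_inv R (\<Delta> - Z) \<inter> ?Y"
      by (rule right_perp_spcl[OF R \<Delta> Z subset_refl _ singleZ[OF Z]]) blast
    moreover have "left_perp R ?Y (Ass_inv R (\<Delta> - Z) \<inter> ?Y) = Ass_inv R Z \<inter> ?Y"
      by (rule left_perp_Ass_inv[OF R \<Delta> Z subset_refl singleY])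
    moreover have "Z \<subseteq> \<Delta>" using Z unfolding spcl_def by blast
    then have "\<Delta> \<inter> Supp_cat R (Ass_inv R Z \<inter> ?Y) = Z"
      using Supp_cat_of_spcl[OF R \<Delta> Z _ Ass_inv_singletons[OF singleY Y]] by blast
    ultimately show ?thesis unfolding Phi[OF Z] Psi_def Let_def by simp
  qed
  have surj: "\<exists>Z\<in>spcl R \<Delta>. P = Phi R \<C> Z" if P: "P \<in> wtp R \<C>" for P
  proof -
    obtain \<T> \<F> where TF: "P = (\<T>, \<F>)" "\<T> \<subseteq> \<C>" "right_perp R \<C> \<T> = \<F>" "left_perp R \<C> \<F> = \<T>"
      using P unfolding wtp_def by blast
    let ?W = "\<Delta> \<inter> Supp_cat R \<T>"
    have W: "?W \<in> spcl R \<Delta>"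
      unfolding spcl_iff[OF R(1) \<Delta>]
    proof (intro conjI ballI impI)
      fix p q assume p: "p \<in> ?W" and q: "q \<in> \<Delta>" "p \<subseteq> q"
      obtain M where M: "M \<in> \<T>" "p \<in> Supp R M" using p unfolding Supp_cat_def by blast
      have "module R M" using M(1) TF(2) CM by (intro mod_cat_module) blast
      moreover have "q \<in> Spec R" using q(1) \<Delta> by blast
      ultimately have "q \<in> Supp R M" using Supp_upward_closed[OF _ M(2) _ q(2)] by simp
      then show "q \<in> ?W" using M(1) q(1) unfolding Supp_cat_def by blast
    qed simp
    have "\<F> = Ass_inv R (\<Delta> - ?W) \<inter> \<C>"
      using right_perp_eq_Ass_inv[OF R(2) C subset_trans[OF TF(2) CM]] TF(3) by simp
    then have "P = Phi R \<C> ?W" using TF(1,4) Phi[OF W] left[OF W] by simp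
    then show ?thesis using W by blast
  qed
  have Psi_spcl: "Psi R \<Delta> P \<in> spcl R \<Delta>" and Phi_Psi: "Phi R \<C> (Psi R \<Delta> P) = P"
    if "P \<in> wtp R \<C>" for P
    using surj[OF that] Psi_Phi by auto
  have "bij_betw (Phi R \<C>) (spcl R \<Delta>) (wtp R \<C>)"
    by (rule bij_betw_byWitness[where f' = "Psi R \<Delta>"]) (use Psi_Phi Phi_Psi Phi_wtp Psi_spcl in auto)
  moreover have "bij_betw (Psi R \<Delta>) (wtp R \<C>) (spcl R \<Delta>)"
    by (rule bij_betw_byWitness[where f' = "Phi R \<C>"]) (use Psi_Phi Phi_Psi Phi_wtp Psi_spcl in auto)
  ultimately show ?thesis using Phi Psi_Phi Phi_Psi unfolding assms(5)[symmetric] by blast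
qed

end
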